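(* Let $d,k\in\mathbb N$ and $1<p<\infty$. For every $f\in L_p(\mathbb R^d)$ and every $t>0$, $$t^{-d/p}\Big(\int_0^{t^d}(f^{\#*}(u))^p\,du\Big)^{1/p}\lesssim\sup_{t<u<\infty}u^{-d/p}\,\omega_k(f,u)_p\qquad\text{if } k>d/p,$$ and $$\Big(\int_0^{t^d}(f^{\#*}(u))^p\,du\Big)^{1/p}\lesssim\omega_k(f,t)_p\qquad\text{if } k\le d/p,$$ with implicit constants independent of $f$ and $t$.
   Context: For measurable $f$ on $\mathbb R^d$ (Lebesgue measure $|\cdot|_d$), $f^*(t)=\inf\{\lambda\ge0:|\{|f|>\lambda\}|_d\le t\}$. For locally integrable $f$, $f^{\#}(x)=\sup_{Q\ni x}\frac1{|Q|_d}\int_Q|f-f_Q|$, supremum over cubes $Q\ni x$ with sides parallel to the axes, $f_Q=\frac1{|Q|_d}\int_Qf$; $f^{\#*}=(f^{\#})^*$. With $\Delta_hf(x)=f(x+h)-f(x)$, $\Delta_h^k=\Delta_h\Delta_h^{k-1}$, the modulus of smoothness is $\omega_k(f,t)_p=\sup_{|h|\le t}\|\Delta_h^kf\|_{L_p(\mathbb R^d)}$. $A\lesssim B$ means $A\le CB$ with $C>0$ depending only on $d,k,p$. *)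

theory Defs
  imports "HOL-Analysis.Analysis"
begin

text \<open>
  The sharp maximal function may be infinite at some points, so all quantities
  below are taken in \<^typ>\<open>ennreal\<close>; suprema and infima are then unconditional.
  Euclidean \<open>d\<close>-space is \<^typ>\<open>real ^ 'n\<close> with \<open>d = CARD('n)\<close>.
\<close>

text \<open>Real powers on \<open>[0, \<infinity>]\<close>; only meant (and only used) for exponents \<open>a > 0\<close>.\<close>

definition epowr :: "ennreal \<Rightarrow> real \<Rightarrow> ennreal" where
  "epowr x a = (if x = top then top else ennreal (enn2real x powr a))"

definition Lp_norm :: "real \<Rightarrow> (real ^ 'n \<Rightarrow> 'b::real_normed_vector) \<Rightarrow> ennreal" where
  "Lp_norm p f = epowr (\<integral>\<^sup>+ x. ennreal (norm (f x) powr p) \<partial>lebesgue) (1 / p)"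

definition Lp :: "real \<Rightarrow> (real ^ 'n \<Rightarrow> 'b::real_normed_vector) set" where
  "Lp p = {f. f \<in> borel_measurable lebesgue \<and> Lp_norm p f < top}"

definition cubes :: "(real ^ 'n) set set" where
  "cubes = {cbox a (a + (\<chi> i. s)) | a s. 0 < s}"

definition average :: "(real ^ 'n) set \<Rightarrow> (real ^ 'n \<Rightarrow> 'b::{banach, second_countable_topology}) \<Rightarrow> 'b" where
  "average Q f = (1 / measure lebesgue Q) *\<^sub>R (LINT x:Q|lebesgue. f x)"

text \<open>
  Meaningful for locally integrable \<open>f\<close>, in particular for \<open>f\<close> in \<^term>\<open>Lp p\<close> with \<open>p \<ge> 1\<close>.
\<close>

definition sharp_maximal ::
  "(real ^ 'n \<Rightarrow> 'b::{banach, second_countable_topology}) \<Rightarrow> real ^ 'n \<Rightarrow> ennreal" where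
  "sharp_maximal f x =
     (SUP Q \<in> {Q \<in> cubes. x \<in> Q}.
        (\<integral>\<^sup>+ y\<in>Q. ennreal (norm (f y - average Q f)) \<partial>lebesgue) / emeasure lebesgue Q)"

text \<open>
  The decreasing rearrangement, for a function \<open>g\<close> that is already nonnegative
  (so \<open>g\<close> plays the role of the absolute value of the function). The infimum over the
  empty set is \<open>\<infinity>\<close>.
\<close>

definition rearrangement :: "(real ^ 'n \<Rightarrow> ennreal) \<Rightarrow> real \<Rightarrow> ennreal" where
  "rearrangement g t =
     Inf {ennreal l | l. 0 \<le> l \<and> emeasure lebesgue {x. g x > ennreal l} \<le> ennreal t}"

definition difference ::
  "real ^ 'n \<Rightarrow> (real ^ 'n \<Rightarrow> 'b::real_normed_vector) \<Rightarrow> real ^ 'n \<Rightarrow> 'b" where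
  "difference h f = (\<lambda>x. f (x + h) - f x)"

definition modulus_of_smoothness ::
  "nat \<Rightarrow> real \<Rightarrow> (real ^ 'n \<Rightarrow> 'b::real_normed_vector) \<Rightarrow> real \<Rightarrow> ennreal" where
  "modulus_of_smoothness k p f t =
     (SUP h \<in> {h. norm h \<le> t}. Lp_norm p ((difference h ^^ k) f))"

end

theory Submission
  imports Defs
begin

text \<open>
  Write \<open>d\<close> for the dimension and \<open>W(t)\<close> for the supremum of \<open>u powr (- d / p) * \<omega>\<^sub>k(f, u)\<close> over
  \<open>u > t\<close>. Averaging \<open>f(x) \<plusminus> \<Delta>\<^sub>h\<^sup>k f(x)\<close> against a Lipschitz bump at scale \<open>t\<close> gives a smooth function
  \<open>f\<^sub>t\<close> with \<open>\<parallel>f - f\<^sub>t\<parallel>\<^sub>p \<le> \<omega>\<^sub>k(f, t)\<close>. Comparing the scales \<open>t, At, A\<^sup>2t, \<dots>\<close> shows that \<open>f\<^sub>t\<close> is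
  Lipschitz with constant at most a multiple of \<open>W(t) / t\<close>; the remainder vanishes because \<open>f\<close> is
  in \<open>L\<^sub>p\<close>. The oscillation of \<open>f\<close> on a cube of side \<open>s \<le> t\<close> is therefore at most twice the mean of
  \<open>|f - f\<^sub>t|\<close> plus a multiple of \<open>W(t)\<close>, and on a cube of side \<open>s > t\<close> the function \<open>f\<^sub>s\<close> and
  Hoelder's inequality bound it by a multiple of \<open>W(t)\<close>. So the sharp function is dominated by
  twice the maximal function of \<open>f - f\<^sub>t\<close> plus a multiple of \<open>W(t)\<close>, and the Hardy-Littlewood
  theorem gives the first inequality, for every \<open>k\<close>. If \<open>k \<le> d / p\<close>, then
  \<open>\<omega>\<^sub>k(f, u) \<le> (2 u / t)\<^sup>k \<omega>\<^sub>k(f, t)\<close> for \<open>u > t\<close> shows \<open>W(t) \<le> 2\<^sup>k t powr (- d / p) * \<omega>\<^sub>k(f, t)\<close>.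
\<close>

subsection \<open>The maximal theorem\<close>

text \<open>Young's inequality in the tangent form
  \<open>p * r powr (p - 1) * a \<le> a powr p + (p - 1) * r powr p\<close>, integrated against
  \<open>w\<close>, does the work of Hoelder's inequality. With nonnegative integrals, finiteness of
  the left side is part of the conclusion, which later yields integrability.\<close>

lemma weighted_power_mean:
  fixes G w :: "'a \<Rightarrow> real"
  assumes p: "1 < p" and m: "0 \<le> m"
    and [measurable]: "G \<in> borel_measurable M" "w \<in> borel_measurable M"
    and G: "\<And>x. 0 \<le> G x" and w: "\<And>x. 0 \<le> w x"
    and w1: "(\<integral>\<^sup>+x. ennreal (w x) \<partial>M) \<le> 1"
    and Gw: "(\<integral>\<^sup>+x. ennreal (G x powr p * w x) \<partial>M) \<le> ennreal (m powr p)"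
  shows "(\<integral>\<^sup>+x. ennreal (G x * w x) \<partial>M) \<le> ennreal m"
proof (rule ennreal_le_epsilon)
  fix e :: real assume "0 < e"
  \<comment> \<open>Choosing \<open>r\<close> slightly above \<open>m\<close> keeps it positive even
    for \<open>m = 0\<close>, so that \<open>p * r powr (p - 1)\<close> can be cancelled at the
    end.\<close>
  define r where "r = m + e"
  have r: "0 < r" "m \<le> r" using \<open>0 < e\<close> m by (auto simp: r_def)
  have young: "(p * r powr (p - 1)) * a \<le> a powr p + (p - 1) * r powr p" if "0 \<le> a" for a
  proof -
    have "a * r powr (p - 1) \<le> a powr p / p + (r powr (p - 1)) powr (p / (p - 1)) / (p / (p - 1))"
      using p that by (intro Youngs_inequality) (auto simp: field_simps)
    also have "(r powr (p - 1)) powr (p / (p - 1)) = r powr p"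
      using p by (simp add: powr_powr)
    finally show ?thesis using p by (simp add: field_simps)
  qed
  have "ennreal (p * r powr (p - 1)) * (\<integral>\<^sup>+x. ennreal (G x * w x) \<partial>M)
      = (\<integral>\<^sup>+x. ennreal (p * r powr (p - 1)) * ennreal (G x * w x) \<partial>M)"
    by (simp add: nn_integral_cmult)
  also have "\<dots> \<le> (\<integral>\<^sup>+x. ennreal (G x powr p * w x) + ennreal ((p - 1) * r powr p) * ennreal (w x) \<partial>M)"
  proof (rule nn_integral_mono)
    fix x
    have "p * r powr (p - 1) * G x * w x \<le> (G x powr p + (p - 1) * r powr p) * w x"
      by (intro mult_right_mono young G w)
    then have "ennreal (p * r powr (p - 1) * G x * w x) \<le> ennreal ((G x powr p + (p - 1) * r powr p) * w x)"
      by (rule ennreal_leI)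
    moreover have "ennreal (p * r powr (p - 1)) * ennreal (G x * w x) = ennreal (p * r powr (p - 1) * G x * w x)"
      using p G[of x] w[of x] by (simp add: ennreal_mult'[symmetric] mult.assoc)
    moreover have "ennreal ((G x powr p + (p - 1) * r powr p) * w x)
        = ennreal (G x powr p * w x) + ennreal ((p - 1) * r powr p) * ennreal (w x)"
      using p G[of x] w[of x] by (simp add: distrib_right ennreal_mult)
    ultimately show "ennreal (p * r powr (p - 1)) * ennreal (G x * w x)
        \<le> ennreal (G x powr p * w x) + ennreal ((p - 1) * r powr p) * ennreal (w x)"
      by simp
  qed
  also have "\<dots> = (\<integral>\<^sup>+x. ennreal (G x powr p * w x) \<partial>M)
      + ennreal ((p - 1) * r powr p) * (\<integral>\<^sup>+x. ennreal (w x) \<partial>M)"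
    by (simp add: nn_integral_add nn_integral_cmult)
  also have "\<dots> \<le> ennreal (m powr p) + ennreal ((p - 1) * r powr p) * 1"
    by (intro add_mono mult_left_mono Gw w1) auto
  also have "\<dots> \<le> ennreal (r powr p) + ennreal ((p - 1) * r powr p)"
    using p m r by (auto intro!: add_mono ennreal_leI powr_mono2)
  also have "\<dots> = ennreal (r powr p + (p - 1) * r powr p)"
    using p by simp
  also have "r powr p + (p - 1) * r powr p = p * r powr p"
    by (simp add: algebra_simps)
  also have "p * r powr p = (p * r powr (p - 1)) * r"
    using r by (simp add: powr_diff)
  also have "ennreal \<dots> = ennreal (p * r powr (p - 1)) * ennreal r"
    using p r by (simp add: ennreal_mult)
  finally show "(\<integral>\<^sup>+x. ennreal (G x * w x) \<partial>M) \<le> ennreal m + ennreal e"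
    using p r m \<open>0 < e\<close>
    by (subst (asm) ennreal_mult_le_mult_iff) (auto simp: r_def)
qed

section \<open>Change of variables and the weak type bound for the maximal function\<close>

lemma nn_integral_lborel_affine:
  fixes G :: "'a::euclidean_space \<Rightarrow> ennreal"
  assumes [measurable]: "G \<in> borel_measurable borel" and "c \<noteq> 0"
  shows "(\<integral>\<^sup>+x. G x \<partial>lborel) = ennreal (\<bar>c\<bar> ^ DIM('a)) * (\<integral>\<^sup>+x. G (t + c *\<^sub>R x) \<partial>lborel)"
  by (subst lborel_affine[OF \<open>c \<noteq> 0\<close>, of t])
     (simp add: nn_integral_density nn_integral_distr nn_integral_cmult)

lemma nn_integral_lborel_translation:
  fixes G :: "'a::euclidean_space \<Rightarrow> ennreal"
  assumes [measurable]: "G \<in> borel_measurable borel"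
  shows "(\<integral>\<^sup>+x. G (x + t) \<partial>lborel) = (\<integral>\<^sup>+x. G x \<partial>lborel)"
  using nn_integral_lborel_affine[OF assms, of 1 t] by (simp add: add.commute)

text \<open>
  The level set is only asserted to lie in a Borel set of controlled measure, so its own
  measurability never has to be discussed.
\<close>

lemma weak_type_maximal:
  fixes G :: "'a::euclidean_space \<Rightarrow> ennreal"
  assumes [measurable]: "G \<in> borel_measurable borel" and l: "0 < l"
  obtains E where "E \<in> sets borel"
    "ennreal l * emeasure lborel E \<le> ennreal (5 ^ DIM('a)) * (\<integral>\<^sup>+x. G x \<partial>lborel)"
    "\<And>x r. 0 < r \<Longrightarrow> ennreal l * emeasure lborel (cball x r) < (\<integral>\<^sup>+y\<in>cball x r. G y \<partial>lborel)
        \<Longrightarrow> cball x r \<subseteq> E"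
proof (cases "(\<integral>\<^sup>+x. G x \<partial>lborel) = \<infinity>")
  case True
  show ?thesis by (rule that[of UNIV]) (auto simp: True ennreal_mult_top)
next
  case False
  then obtain I where I: "0 \<le> I" "(\<integral>\<^sup>+x. G x \<partial>lborel) = ennreal I"
    by (cases "\<integral>\<^sup>+x. G x \<partial>lborel") auto
  define V where "V = unit_ball_vol (real DIM('a))"
  have V: "0 < V" by (simp add: V_def)
  define K where "K = {(x::'a, r). 0 < r \<and>
      ennreal l * emeasure lborel (cball x r) < (\<integral>\<^sup>+y\<in>cball x r. G y \<partial>lborel)}"
  have vol: "emeasure lborel (cball x r) = ennreal (V * r ^ DIM('a))" if "0 \<le> r" for x :: 'a and r
    using that by (simp add: emeasure_cball V_def)
  have le: "l * (V * r ^ DIM('a)) \<le> I" if "(x, r) \<in> K" for x r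
  proof -
    have "ennreal (l * (V * r ^ DIM('a))) \<le> (\<integral>\<^sup>+y\<in>cball x r. G y \<partial>lborel)"
      using that l V by (auto simp: K_def vol ennreal_mult less_imp_le)
    also have "\<dots> \<le> (\<integral>\<^sup>+y. G y \<partial>lborel)"
      by (intro nn_integral_mono) (auto split: split_indicator)
    finally show ?thesis using I by simp
  qed
  \<comment> \<open>Vitali's covering lemma needs uniformly bounded radii. The volume bound
    \<open>le\<close> supplies this, since \<open>r \<le> r ^ DIM('a)\<close> as soon as
    \<open>1 \<le> r\<close>.\<close>
  have bound: "0 < snd i \<and> snd i \<le> max 1 (I / (l * V))" if "i \<in> K" for i
  proof -
    obtain x r where i: "i = (x, r)" by force
    have "0 < r" using that by (auto simp: K_def i)
    have "r \<le> I / (l * V)" if "1 \<le> r"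
    proof -
      have "r ^ 1 \<le> r ^ DIM('a)" using that by (intro power_increasing) auto
      also have "\<dots> \<le> I / (l * V)"
        using le[OF \<open>i \<in> K\<close>[unfolded i]] l V by (simp add: field_simps)
      finally show ?thesis by simp
    qed
    then show ?thesis using \<open>0 < r\<close> by (cases "1 \<le> r") (auto simp: i max_def)
  qed
  obtain C where C: "countable C" "C \<subseteq> K"
     and disj: "pairwise (\<lambda>i j. disjnt (cball (fst i) (snd i)) (cball (fst j) (snd j))) C"
     and cov: "(\<Union>i\<in>K. cball (fst i) (snd i)) \<subseteq> (\<Union>i\<in>C. cball (fst i) (5 * snd i))"
    by (rule Vitali_covering_lemma_cballs[OF subset_refl bound])
  define E where "E = (\<Union>i\<in>C. cball (fst i) (5 * snd i))"
  have fm: "cball (fst i) (5 * snd i) \<in> fmeasurable lborel" for i :: "'a \<times> real"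
    by (intro fmeasurableI) (auto intro!: emeasure_bounded_finite[unfolded infinity_ennreal_def])
  \<comment> \<open>Reading \<open>G\<close> as a density turns the sum over the disjoint selected
    balls into the measure of their union, at most \<open>I\<close>; the fivefold enlargement costs
    \<open>5 ^ DIM('a)\<close>. Being uniform in the finite set \<open>F\<close>, the bound passes
    to the countable union.\<close>
  have fin: "measure lborel (\<Union>i\<in>F. cball (fst i) (5 * snd i)) \<le> 5 ^ DIM('a) * I / l"
    if F: "F \<subseteq> C" "finite F" for F
  proof -
    have pos: "0 < snd i" if "i \<in> F" for i using that F C bound by blast
    have "ennreal (\<Sum>i\<in>F. l * (V * snd i ^ DIM('a))) = (\<Sum>i\<in>F. ennreal (l * (V * snd i ^ DIM('a))))"
      using l V pos by (intro sum_ennreal[symmetric]) (auto simp: less_imp_le)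
    also have "\<dots> \<le> (\<Sum>i\<in>F. (\<integral>\<^sup>+y\<in>cball (fst i) (snd i). G y \<partial>lborel))"
    proof (rule sum_mono)
      fix i assume "i \<in> F"
      then have "(fst i, snd i) \<in> K" using F C by auto
      then show "ennreal (l * (V * snd i ^ DIM('a))) \<le> (\<integral>\<^sup>+y\<in>cball (fst i) (snd i). G y \<partial>lborel)"
        using l V by (auto simp: K_def vol ennreal_mult less_imp_le)
    qed
    also have "\<dots> = (\<Sum>i\<in>F. emeasure (density lborel G) (cball (fst i) (snd i)))"
      by (simp add: emeasure_density)
    also have "\<dots> = emeasure (density lborel G) (\<Union>i\<in>F. cball (fst i) (snd i))"
    proof (intro sum_emeasure)
      have "pairwise (\<lambda>i j. disjnt (cball (fst i) (snd i)) (cball (fst j) (snd j))) F"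
        using disj F(1) by (rule pairwise_subset)
      then show "disjoint_family_on (\<lambda>i. cball (fst i) (snd i)) F"
        by (simp add: disjoint_family_on_def pairwise_def disjnt_def)
    qed (use F in auto)
    also have "\<dots> \<le> emeasure (density lborel G) UNIV"
      by (intro emeasure_mono) auto
    also have "\<dots> = ennreal I"
      by (simp add: emeasure_density I)
    finally have *: "(\<Sum>i\<in>F. l * (V * snd i ^ DIM('a))) \<le> I"
      using I by simp
    have "measure lborel (\<Union>i\<in>F. cball (fst i) (5 * snd i))
        \<le> (\<Sum>i\<in>F. measure lborel (cball (fst i) (5 * snd i)))"
      using F fm by (intro measure_UNION_le) auto
    also have "\<dots> = (\<Sum>i\<in>F. 5 ^ DIM('a) / l * (l * (V * snd i ^ DIM('a))))"
      using pos l by (intro sum.cong refl)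
        (simp add: content_cball less_imp_le V_def power_mult_distrib)
    also have "\<dots> = 5 ^ DIM('a) / l * (\<Sum>i\<in>F. (l * (V * snd i ^ DIM('a))))"
      by (simp add: sum_distrib_left)
    also have "\<dots> \<le> 5 ^ DIM('a) / l * I"
      using l by (intro mult_left_mono *) auto
    finally show ?thesis by simp
  qed
  have E: "E \<in> fmeasurable lborel" "measure lborel E \<le> 5 ^ DIM('a) * I / l"
    unfolding E_def
    using fmeasurable_UN_bound[OF C(1) fm fin] measure_UN_bound[OF C(1) fm fin] by auto
  show ?thesis
  proof (rule that[of E])
    show "E \<in> sets borel" using E(1) by (auto simp: fmeasurable_def)
    have "ennreal l * emeasure lborel E = ennreal (l * measure lborel E)"
      using E(1) l by (simp add: emeasure_eq_measure2 ennreal_mult)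
    also have "\<dots> \<le> ennreal (5 ^ DIM('a) * I)"
      using E(2) l by (intro ennreal_leI) (simp add: field_simps)
    also have "\<dots> = ennreal (5 ^ DIM('a)) * (\<integral>\<^sup>+x. G x \<partial>lborel)"
      using I by (simp add: ennreal_mult)
    finally show "ennreal l * emeasure lborel E \<le> ennreal (5 ^ DIM('a)) * (\<integral>\<^sup>+x. G x \<partial>lborel)" .
    show "cball x r \<subseteq> E"
      if "0 < r" "ennreal l * emeasure lborel (cball x r) < (\<integral>\<^sup>+y\<in>cball x r. G y \<partial>lborel)" for x r
    proof -
      have "(x, r) \<in> K" using that by (auto simp: K_def)
      then have "cball x r \<subseteq> (\<Union>i\<in>K. cball (fst i) (snd i))" by force
      then show ?thesis using cov by (simp add: E_def)
    qed
  qed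
qed

section \<open>Layer-cake integration and decreasing rearrangements\<close>

lemma nn_integral_powr_from_0:
  assumes "-1 < a" "0 \<le> c"
  shows "(\<integral>\<^sup>+l. ennreal (if 0 < l \<and> l < c then l powr a else 0) \<partial>lborel)
    = ennreal (c powr (a + 1) / (a + 1))"
proof -
  \<comment> \<open>Only the endpoint \<open>c\<close> has to be discarded as a null set: at
    \<open>l = 0\<close> both integrands vanish because \<open>0 powr a = 0\<close>.\<close>
  have "(\<integral>\<^sup>+l. ennreal (if 0 < l \<and> l < c then l powr a else 0) \<partial>lborel)
      = (\<integral>\<^sup>+l. ennreal (if l \<in> {0..c} then l powr a else 0) \<partial>lborel)"
    using AE_lborel_singleton[of c]
    by (intro nn_integral_cong_AE) (auto elim!: eventually_mono)
  also have "\<dots> = ennreal (c powr (a + 1) / (a + 1))"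
    using has_integral_powr_from_0[OF assms]
    by (intro nn_integral_has_integral_lborel) (auto simp only: has_integral_restrict_UNIV powr_ge_zero if_split, measurable)
  finally show ?thesis .
qed

lemma emeasure_less_ennreal: "emeasure lborel {u::real. 0 < u \<and> ennreal u < D} \<le> D"
proof (cases D)
  case (real d)
  have "emeasure lborel {u::real. 0 < u \<and> ennreal u < D} \<le> emeasure lborel {0..d}"
    using real by (intro emeasure_mono) (auto simp: ennreal_less_iff)
  then show ?thesis using real by simp
qed simp

text \<open>\<open>D l\<close> is a weak type bound for a truncated function, and the double
  integral encodes the condition \<open>u < D l\<close>. Integrating first in \<open>u\<close> gives
  \<open>p * l powr (p - 1) * D l\<close>; a second exchange leaves, for each \<open>x\<close>, the
  integral of \<open>l powr (p - 2)\<close> over \<open>0 < l < c * G x\<close>. This converges at 0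
  because \<open>1 < p\<close> and produces the factor \<open>p / (p - 1)\<close>.\<close>

lemma layer_cake_bound:
  fixes G :: "'a::euclidean_space \<Rightarrow> real"
  assumes p: "1 < p" and c: "0 < c" and K: "0 \<le> K"
    and [measurable]: "G \<in> borel_measurable borel" and G: "\<And>x. 0 \<le> G x"
  defines "D \<equiv> \<lambda>l. ennreal (K / l) * (\<integral>\<^sup>+x. (if l < c * G x then ennreal (G x) else 0) \<partial>lborel)"
  shows "(\<lambda>(u, l). if 0 < u \<and> 0 < l \<and> ennreal u < D l then ennreal (p * l powr (p - 1)) else 0)
      \<in> borel_measurable (lborel \<Otimes>\<^sub>M lborel)"
    and "(\<integral>\<^sup>+u. (\<integral>\<^sup>+l. (if 0 < u \<and> 0 < l \<and> ennreal u < D l then ennreal (p * l powr (p - 1)) else 0)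
        \<partial>lborel) \<partial>lborel)
      \<le> ennreal (K * c powr (p - 1) * p / (p - 1)) * (\<integral>\<^sup>+x. ennreal (G x powr p) \<partial>lborel)"
proof -
  have [measurable]: "D \<in> borel_measurable borel"
    unfolding D_def by measurable
  show meas[measurable]: "(\<lambda>(u, l). if 0 < u \<and> 0 < l \<and> ennreal u < D l then ennreal (p * l powr (p - 1)) else 0)
      \<in> borel_measurable (lborel \<Otimes>\<^sub>M lborel)"
    by measurable
  have "(\<integral>\<^sup>+u. (\<integral>\<^sup>+l. (if 0 < u \<and> 0 < l \<and> ennreal u < D l then ennreal (p * l powr (p - 1)) else 0)
        \<partial>lborel) \<partial>lborel)
     = (\<integral>\<^sup>+l. (\<integral>\<^sup>+u. (if 0 < u \<and> 0 < l \<and> ennreal u < D l then ennreal (p * l powr (p - 1)) else 0)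
        \<partial>lborel) \<partial>lborel)"
    by (rule lborel_pair.Fubini'[symmetric]) (rule meas)
  also have "\<dots> \<le> (\<integral>\<^sup>+l. (\<integral>\<^sup>+x. ennreal (K * p * G x) *
      ennreal (if 0 < l \<and> l < c * G x then l powr (p - 2) else 0) \<partial>lborel) \<partial>lborel)"
  proof (rule nn_integral_mono)
    fix l :: real
    have "(\<integral>\<^sup>+u. (if 0 < u \<and> 0 < l \<and> ennreal u < D l then ennreal (p * l powr (p - 1)) else 0) \<partial>lborel)
      = (if 0 < l then ennreal (p * l powr (p - 1)) else 0) * emeasure lborel {u::real. 0 < u \<and> ennreal u < D l}"
      by (subst nn_integral_cmult_indicator[symmetric])
         (auto intro!: nn_integral_cong split: split_indicator)
    also have "\<dots> \<le> (if 0 < l then ennreal (p * l powr (p - 1)) else 0) * D l"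
      by (intro mult_left_mono emeasure_less_ennreal) auto
    also have "\<dots> = (\<integral>\<^sup>+x. ennreal (K * p * G x) *
      ennreal (if 0 < l \<and> l < c * G x then l powr (p - 2) else 0) \<partial>lborel)"
    proof (cases "0 < l")
      case True
      have eq: "p * l powr (p - 1) * K * y / l = K * p * y * l powr (p - 2)" for y
        using True powr_add[of l "p - 2" 1] by (simp add: field_simps)
      have "ennreal (p * l powr (p - 1)) * D l
        = (\<integral>\<^sup>+x. ennreal (p * l powr (p - 1) * (K / l)) * (if l < c * G x then ennreal (G x) else 0) \<partial>lborel)"
        unfolding D_def mult.assoc[symmetric] using True p K
        by (subst ennreal_mult[symmetric]) (auto simp: nn_integral_cmult)
      also have "\<dots> = (\<integral>\<^sup>+x. ennreal (K * p * G x) *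
          ennreal (if 0 < l \<and> l < c * G x then l powr (p - 2) else 0) \<partial>lborel)"
        using True p K G by (intro nn_integral_cong) (auto simp: ennreal_mult[symmetric] eq)
      finally show ?thesis using True by simp
    qed simp
    finally show "(\<integral>\<^sup>+u. (if 0 < u \<and> 0 < l \<and> ennreal u < D l then ennreal (p * l powr (p - 1)) else 0) \<partial>lborel)
      \<le> (\<integral>\<^sup>+x. ennreal (K * p * G x) * ennreal (if 0 < l \<and> l < c * G x then l powr (p - 2) else 0) \<partial>lborel)" .
  qed
  also have "\<dots> = (\<integral>\<^sup>+x. (\<integral>\<^sup>+l. ennreal (K * p * G x) *
      ennreal (if 0 < l \<and> l < c * G x then l powr (p - 2) else 0) \<partial>lborel) \<partial>lborel)"
    by (rule lborel_pair.Fubini') measurable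
  also have "\<dots> = (\<integral>\<^sup>+x. ennreal (K * c powr (p - 1) * p / (p - 1)) * ennreal (G x powr p) \<partial>lborel)"
  proof (rule nn_integral_cong)
    fix x
    have "(\<integral>\<^sup>+l. ennreal (K * p * G x) * ennreal (if 0 < l \<and> l < c * G x then l powr (p - 2) else 0) \<partial>lborel)
      = ennreal (K * p * G x) * ennreal ((c * G x) powr (p - 2 + 1) / (p - 2 + 1))"
      using p c G by (subst nn_integral_powr_from_0[symmetric]) (auto simp: nn_integral_cmult)
    also have "\<dots> = ennreal (K * p * G x * ((c * G x) powr (p - 1) / (p - 1)))"
      using p c G K by (simp add: ennreal_mult[symmetric])
    also have "K * p * G x * ((c * G x) powr (p - 1) / (p - 1))
        = (K * c powr (p - 1) * p / (p - 1)) * G x powr p"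
    proof (cases "G x = 0")
      case False
      then have "G x powr p = G x * G x powr (p - 1)"
        using G[of x] powr_add[of "G x" 1 "p - 1"] by simp
      then show ?thesis using G c by (simp add: powr_mult)
    qed simp
    finally show "(\<integral>\<^sup>+l. ennreal (K * p * G x) * ennreal (if 0 < l \<and> l < c * G x then l powr (p - 2) else 0) \<partial>lborel)
      = ennreal (K * c powr (p - 1) * p / (p - 1)) * ennreal (G x powr p)"
      using p K by (subst ennreal_mult[symmetric]) auto
  qed
  also have "\<dots> = ennreal (K * c powr (p - 1) * p / (p - 1)) * (\<integral>\<^sup>+x. ennreal (G x powr p) \<partial>lborel)"
    by (simp add: nn_integral_cmult)
  finally show "(\<integral>\<^sup>+u. (\<integral>\<^sup>+l. (if 0 < u \<and> 0 < l \<and> ennreal u < D l then ennreal (p * l powr (p - 1)) else 0)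
        \<partial>lborel) \<partial>lborel)
      \<le> ennreal (K * c powr (p - 1) * p / (p - 1)) * (\<integral>\<^sup>+x. ennreal (G x powr p) \<partial>lborel)" .
qed

lemma powr_add_le:
  fixes a b p :: real
  assumes "0 \<le> a" "0 \<le> b" "0 \<le> p"
  shows "(a + b) powr p \<le> 2 powr p * (a powr p + b powr p)"
proof -
  have "(a + b) powr p \<le> (2 * max a b) powr p"
    using assms by (intro powr_mono2) auto
  also have "\<dots> = 2 powr p * max a b powr p"
    using assms by (simp add: powr_mult)
  also have "\<dots> \<le> 2 powr p * (a powr p + b powr p)"
    by (intro mult_left_mono) (auto simp: max_def)
  finally show ?thesis .
qed

lemma epowr_le_iff:
  assumes "0 < a" "0 \<le> m"
  shows "epowr x a \<le> ennreal m \<longleftrightarrow> x \<le> ennreal (m powr (1 / a))"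
proof (cases x)
  case (real r)
  have "r powr a \<le> m \<longleftrightarrow> r \<le> m powr (1 / a)"
  proof
    assume "r powr a \<le> m"
    then have "(r powr a) powr (1 / a) \<le> m powr (1 / a)"
      using assms by (intro powr_mono2) auto
    then show "r \<le> m powr (1 / a)"
      using assms real by (simp add: powr_powr)
  next
    assume "r \<le> m powr (1 / a)"
    then have "r powr a \<le> (m powr (1 / a)) powr a"
      using assms real by (intro powr_mono2) auto
    then show "r powr a \<le> m"
      using assms by (simp add: powr_powr)
  qed
  then show ?thesis using real assms by (simp add: epowr_def)
qed (use assms in \<open>auto simp: epowr_def top_unique\<close>)

text \<open>If the rearrangement at \<open>u\<close> exceeds \<open>B + l\<close>, the level set at
  that height has measure above \<open>u\<close>, hence \<open>u < D l\<close>. Writing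
  \<open>r powr p\<close> as the integral of \<open>p * l powr (p - 1)\<close> over
  \<open>0 < l < r\<close> therefore bounds the excess \<open>r\<close> over \<open>B\<close> by an
  integral of the form handled in \<open>layer_cake_bound\<close>.\<close>

lemma rearrangement_powr_le:
  fixes \<Phi> :: "real ^ 'n \<Rightarrow> ennreal"
  assumes p: "1 < p" and B: "0 \<le> B" and u: "0 < u"
    and E: "\<And>l. 0 < l \<Longrightarrow> emeasure lebesgue {x. \<Phi> x > ennreal (B + l)} \<le> D l"
  shows "epowr (rearrangement \<Phi> u) p \<le> ennreal (2 powr p) * (ennreal (B powr p) +
    (\<integral>\<^sup>+l. (if 0 < u \<and> 0 < l \<and> ennreal u < D l then ennreal (p * l powr (p - 1)) else 0) \<partial>lborel))"
    (is "_ \<le> _ * (_ + ?H)")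
proof -
  have low: "ennreal (r powr p) \<le> ?H"
    if r: "0 \<le> r" and less: "\<And>l. 0 < l \<Longrightarrow> l < r \<Longrightarrow> ennreal (B + l) < rearrangement \<Phi> u" for r
  proof -
    have D: "ennreal u < D l" if "0 < l" "l < r" for l
    proof (rule ccontr)
      assume "\<not> ennreal u < D l"
      then have "rearrangement \<Phi> u \<le> ennreal (B + l)"
        unfolding rearrangement_def using E[OF \<open>0 < l\<close>] B \<open>0 < l\<close>
        by (intro Inf_lower CollectI exI[of _ "B + l"]) auto
      then show False using less[OF that] by simp
    qed
    have "ennreal (r powr p) = ennreal p * ennreal (r powr (p - 1 + 1) / (p - 1 + 1))"
      using p r by (simp add: ennreal_mult[symmetric])
    also have "\<dots> = (\<integral>\<^sup>+l. ennreal p * ennreal (if 0 < l \<and> l < r then l powr (p - 1) else 0) \<partial>lborel)"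
      using p r by (subst nn_integral_powr_from_0[symmetric]) (auto simp: nn_integral_cmult)
    also have "\<dots> \<le> ?H"
      using p u D by (intro nn_integral_mono) (auto simp: ennreal_mult)
    finally show ?thesis .
  qed
  show ?thesis
  proof (cases "rearrangement \<Phi> u")
    case top
    have "?H = top"
    proof (cases ?H)
      case (real h)
      \<comment> \<open>For an infinite rearrangement every \<open>r\<close> is admissible in
        \<open>low\<close>; this choice gives \<open>h + 1 \<le> h\<close>, so the integral cannot
        be the finite number \<open>h\<close>.\<close>
      have "ennreal (((h + 1) powr (1 / p)) powr p) \<le> ?H"
        by (rule low) (auto simp: top)
      then show ?thesis using real p by (simp add: powr_powr)
    qed
    then show ?thesis by (simp add: ennreal_mult_top)
  next
    case (real r)
    have "ennreal (r powr p) \<le> ennreal (2 powr p) * (ennreal (B powr p) + ?H)"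
    proof (cases "r \<le> B")
      case True
      have "ennreal (r powr p) \<le> ennreal (B powr p)"
        using True real p by (intro ennreal_leI powr_mono2) auto
      also have "\<dots> \<le> ennreal (2 powr p) * ennreal (B powr p)"
        using p by (simp add: ennreal_mult[symmetric] mult_le_cancel_right1 ge_one_powr_ge_zero)
      also have "\<dots> \<le> ennreal (2 powr p) * (ennreal (B powr p) + ?H)"
        by (intro mult_left_mono) auto
      finally show ?thesis .
    next
      case False
      have "r powr p \<le> 2 powr p * (B powr p + (r - B) powr p)"
        using powr_add_le[of B "r - B" p] False B p by simp
      then have "ennreal (r powr p) \<le> ennreal (2 powr p) * (ennreal (B powr p) + ennreal ((r - B) powr p))"
        by (simp add: ennreal_mult[symmetric] ennreal_plus[symmetric] del: ennreal_plus)
      also have "\<dots> \<le> ennreal (2 powr p) * (ennreal (B powr p) + ?H)"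
        using False B by (intro mult_left_mono add_mono low) (auto simp: real ennreal_less_iff simp del: ennreal_plus)
      finally show ?thesis .
    qed
    then show ?thesis using real by (simp add: epowr_def)
  qed
qed

lemma emeasure_cube:
  assumes "0 < s"
  shows "emeasure lborel (cbox a (a + (\<chi> i. s)) :: (real ^ 'n) set) = ennreal (s ^ CARD('n))"
proof -
  have "((a + (\<chi> i. s) :: real ^ 'n) - a) \<bullet> b = s" if "b \<in> Basis" for b
    using that by (auto simp: Basis_vec_def inner_axis)
  moreover have "a \<bullet> b \<le> (a + (\<chi> i. s) :: real ^ 'n) \<bullet> b" if "b \<in> Basis" for b
    using that assms by (auto simp: Basis_vec_def inner_axis)
  ultimately show ?thesis
    by (simp add: emeasure_lborel_cbox)
qed

lemma cube_norm_diff_le: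
  fixes a x y :: "real ^ 'n" and s :: real
  assumes "x \<in> cbox a (a + (\<chi> i. s))" "y \<in> cbox a (a + (\<chi> i. s))"
  shows "norm (x - y) \<le> CARD('n) * s"
proof -
  have "norm (x - y) \<le> (\<Sum>i\<in>UNIV. \<bar>(x - y) $ i\<bar>)" by (rule norm_le_l1_cart)
  also have "\<dots> \<le> (\<Sum>i\<in>(UNIV::'n set). s)"
  proof (rule sum_mono)
    fix i
    have "a $ i \<le> x $ i" "x $ i \<le> a $ i + s" "a $ i \<le> y $ i" "y $ i \<le> a $ i + s"
      using assms by (auto simp: mem_box_cart)
    then show "\<bar>(x - y) $ i\<bar> \<le> s" by (simp add: abs_le_iff)
  qed
  finally show ?thesis by simp
qed

text \<open>This is Marcinkiewicz interpolation. The hypothesis says that wherever \<Phi> exceeds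
  \<open>B + l\<close>, some cube through the point has mean of \<open>G\<close> above
  \<open>l / 2\<close>. The weak type bound for a truncation of \<open>G\<close> at height
  \<open>l / 4\<close> controls the level sets by \<open>D l\<close>, and
  \<open>layer_cake_bound\<close> with \<open>c = 4\<close> integrates the result.\<close>

lemma rearrangement_maximal_bound:
  fixes \<Phi> :: "real ^ 'n \<Rightarrow> ennreal" and G :: "real ^ 'n \<Rightarrow> real"
  assumes p: "1 < p" and B: "0 \<le> B" and T: "0 \<le> T"
    and [measurable]: "G \<in> borel_measurable borel" and G: "\<And>x. 0 \<le> G x"
    and \<Phi>: "\<And>x l. ennreal (B + l) < \<Phi> x \<Longrightarrow> 0 < l \<Longrightarrow>
      \<exists>a s. 0 < s \<and> x \<in> cbox a (a + (\<chi> i. s)) \<and>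
        ennreal (l / 2 * s ^ CARD('n)) < (\<integral>\<^sup>+y\<in>cbox a (a + (\<chi> i. s)). ennreal (G y) \<partial>lborel)"
  defines "V \<equiv> unit_ball_vol (real CARD('n)) * real CARD('n) ^ CARD('n)"
  shows "(\<integral>\<^sup>+u\<in>{0<..<T}. epowr (rearrangement \<Phi> u) p \<partial>lborel)
    \<le> ennreal (2 powr p) * (ennreal (T * B powr p) +
        ennreal ((5 ^ CARD('n) * 4 * V) * 4 powr (p - 1) * p / (p - 1)) * (\<integral>\<^sup>+x. ennreal (G x powr p) \<partial>lborel))"
proof -
  have V: "0 < V" by (simp add: V_def)
  define K where "K = 5 ^ CARD('n) * 4 * V"
  have K: "0 \<le> K" using V by (simp add: K_def)
  define D where "D = (\<lambda>l. ennreal (K / l) * (\<integral>\<^sup>+x. (if l < 4 * G x then ennreal (G x) else 0) \<partial>lborel))"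
  define H where "H = (\<lambda>u. \<integral>\<^sup>+l. (if 0 < u \<and> 0 < l \<and> ennreal u < D l then ennreal (p * l powr (p - 1)) else 0) \<partial>lborel)"
  have H: "(\<integral>\<^sup>+u. H u \<partial>lborel)
      \<le> ennreal (K * 4 powr (p - 1) * p / (p - 1)) * (\<integral>\<^sup>+x. ennreal (G x powr p) \<partial>lborel)"
    unfolding H_def D_def by (rule layer_cake_bound(2)) (use p K G in auto)
  have E: "emeasure lebesgue {x. \<Phi> x > ennreal (B + l)} \<le> D l" if l: "0 < l" for l
  proof -
    \<comment> \<open>The values of \<open>G\<close> up to \<open>l / 4\<close> contribute at most
      \<open>l / 4\<close> to a mean, so on a cube where \<open>G\<close> has mean above
      \<open>l / 2\<close> the truncation \<open>G1\<close> still has mean above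
      \<open>l / 4\<close>.\<close>
    define G1 where "G1 = (\<lambda>x. if l < 4 * G x then ennreal (G x) else 0)"
    have [measurable]: "G1 \<in> borel_measurable borel" by (simp add: G1_def)
    obtain E where [measurable]: "E \<in> sets borel"
      and E: "ennreal (l / (4 * V)) * emeasure lborel E \<le> ennreal (5 ^ CARD('n)) * (\<integral>\<^sup>+x. G1 x \<partial>lborel)"
      and sub: "\<And>x r. 0 < r \<Longrightarrow> ennreal (l / (4 * V)) * emeasure lborel (cball x r) < (\<integral>\<^sup>+y\<in>cball x r. G1 y \<partial>lborel)
        \<Longrightarrow> cball x r \<subseteq> E"
      using weak_type_maximal[of G1 "l / (4 * V)"] l V by auto
    have "{x. \<Phi> x > ennreal (B + l)} \<subseteq> E"
    proof safe
      fix x assume "ennreal (B + l) < \<Phi> x"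
      from \<Phi>[OF this l] obtain a s where s: "0 < s" "x \<in> cbox a (a + (\<chi> i. s))"
        and big: "ennreal (l / 2 * s ^ CARD('n)) < (\<integral>\<^sup>+y\<in>cbox a (a + (\<chi> i. s)). ennreal (G y) \<partial>lborel)"
        by blast
      let ?Q = "cbox a (a + (\<chi> i. s))"
      \<comment> \<open>This ball about the corner of the cube contains the cube and has volume
        \<open>V * s ^ CARD('n)\<close>; passing from cubes to balls thus divides the level
        \<open>l / 4\<close> by \<open>V\<close>.\<close>
      let ?ball = "cball a (CARD('n) * s)"
      have "a \<in> ?Q" using s by (auto simp: mem_box_cart)
      then have Qb: "?Q \<subseteq> ?ball"
        using cube_norm_diff_le by (auto simp: dist_norm)
      have "ennreal (l / 4 * s ^ CARD('n)) + ennreal (l / 4 * s ^ CARD('n)) = ennreal (l / 2 * s ^ CARD('n))"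
        using l s by (simp add: ennreal_plus[symmetric] del: ennreal_plus)
      also note big
      also have "(\<integral>\<^sup>+y\<in>?Q. ennreal (G y) \<partial>lborel)
          \<le> (\<integral>\<^sup>+y. ennreal (l / 4) * indicator ?Q y + G1 y * indicator ?Q y \<partial>lborel)"
        using l G by (intro nn_integral_mono) (auto simp: G1_def not_less ennreal_leI split: split_indicator)
      also have "\<dots> = ennreal (l / 4 * s ^ CARD('n)) + (\<integral>\<^sup>+y\<in>?Q. G1 y \<partial>lborel)"
        using l s by (subst ennreal_mult, auto simp: nn_integral_add nn_integral_cmult emeasure_cube)
      also have "(\<integral>\<^sup>+y\<in>?Q. G1 y \<partial>lborel) \<le> (\<integral>\<^sup>+y\<in>?ball. G1 y \<partial>lborel)"
        using Qb by (intro nn_integral_mono) (auto split: split_indicator)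
      finally have "ennreal (l / 4 * s ^ CARD('n)) < (\<integral>\<^sup>+y\<in>?ball. G1 y \<partial>lborel)"
        by (auto simp: ennreal_add_left_cancel_less)
      also have "ennreal (l / 4 * s ^ CARD('n)) = ennreal (l / (4 * V)) * emeasure lborel ?ball"
        using l s by (simp add: emeasure_cball ennreal_mult[symmetric] V_def power_mult_distrib
            less_imp_neq[OF unit_ball_vol_pos, symmetric])
      finally have "?ball \<subseteq> E"
        using s by (intro sub) auto
      then show "x \<in> E" using s Qb by auto
    qed
    then have "emeasure lebesgue {x. \<Phi> x > ennreal (B + l)} \<le> emeasure lebesgue E"
      by (intro emeasure_mono) auto
    also have "\<dots> = ennreal (4 * V / l) * (ennreal (l / (4 * V)) * emeasure lborel E)"
      using l V by (simp add: mult.assoc[symmetric] ennreal_mult[symmetric])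
    also have "\<dots> \<le> ennreal (4 * V / l) * (ennreal (5 ^ CARD('n)) * (\<integral>\<^sup>+x. G1 x \<partial>lborel))"
      by (intro mult_left_mono E) auto
    also have "\<dots> = ennreal (4 * V / l * 5 ^ CARD('n)) * (\<integral>\<^sup>+x. G1 x \<partial>lborel)"
      using l V by (subst ennreal_mult) (auto simp: mult.assoc)
    also have "\<dots> = D l"
      by (simp add: D_def G1_def K_def mult_ac)
    finally show ?thesis .
  qed
  have "H \<in> borel_measurable lborel"
    unfolding H_def D_def
    by (rule lborel.borel_measurable_nn_integral, rule layer_cake_bound(1)) (use p K G in auto)
  then have [measurable]: "H \<in> borel_measurable borel"
    by simp
  have "(\<integral>\<^sup>+u\<in>{0<..<T}. epowr (rearrangement \<Phi> u) p \<partial>lborel)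
    \<le> (\<integral>\<^sup>+u. ennreal (2 powr p) * (ennreal (B powr p) * indicator {0<..<T} u + H u) \<partial>lborel)"
  proof (rule nn_integral_mono)
    fix u :: real
    show "epowr (rearrangement \<Phi> u) p * indicator {0<..<T} u
        \<le> ennreal (2 powr p) * (ennreal (B powr p) * indicator {0<..<T} u + H u)"
    proof (cases "u \<in> {0<..<T}")
      case True
      then have "epowr (rearrangement \<Phi> u) p \<le> ennreal (2 powr p) * (ennreal (B powr p) + H u)"
        unfolding H_def by (intro rearrangement_powr_le p B E) auto
      then show ?thesis using True by simp
    qed simp
  qed
  also have "\<dots> = ennreal (2 powr p) * (ennreal (T * B powr p) + (\<integral>\<^sup>+u. H u \<partial>lborel))"
    using T by (simp add: nn_integral_cmult nn_integral_add ennreal_mult mult.commute)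
  also have "\<dots> \<le> ennreal (2 powr p) * (ennreal (T * B powr p) +
        ennreal (K * 4 powr (p - 1) * p / (p - 1)) * (\<integral>\<^sup>+x. ennreal (G x powr p) \<partial>lborel))"
    by (intro mult_left_mono add_left_mono H) auto
  finally show ?thesis by (simp add: K_def)
qed

subsection \<open>Mollification of functions in \<open>L\<^sub>p\<close>\<close>

text \<open>The number \<open>m\<close> is an upper bound and need not be the norm. Keeping it real
  avoids arithmetic with infinity, and asking for Borel rather than Lebesgue measurability makes
  translates and joint integrands measurable.\<close>

definition Lp_bound :: "real \<Rightarrow> ('a::euclidean_space \<Rightarrow> 'b::real_normed_vector) \<Rightarrow> real \<Rightarrow> bool" where
  "Lp_bound p f m \<longleftrightarrow> f \<in> borel_measurable borel \<and> 0 \<le> m \<and>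
     (\<integral>\<^sup>+x. ennreal (norm (f x) powr p) \<partial>lborel) \<le> ennreal (m powr p)"

lemma Lp_boundD:
  assumes "Lp_bound p f m"
  shows "f \<in> borel_measurable borel" "0 \<le> m"
    "(\<integral>\<^sup>+x. ennreal (norm (f x) powr p) \<partial>lborel) \<le> ennreal (m powr p)"
  using assms by (auto simp: Lp_bound_def)

lemma Lp_bound_mono:
  assumes "Lp_bound p f m" "m \<le> m'" "0 \<le> p"
  shows "Lp_bound p f m'"
proof -
  have "ennreal (m powr p) \<le> ennreal (m' powr p)"
    using assms by (intro ennreal_leI powr_mono2) (auto simp: Lp_bound_def)
  from order_trans[OF Lp_boundD(3)[OF assms(1)] this] show ?thesis
    using assms by (auto simp: Lp_bound_def)
qed

text \<open>The crude factor 4 is harmless: bounds derived from it only certify finiteness and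
  measurability and never enter the final constant.\<close>

lemma Lp_bound_diff:
  fixes f g :: "'a::euclidean_space \<Rightarrow> 'b::{banach, second_countable_topology}"
  assumes p: "1 < p" and f: "Lp_bound p f m" and g: "Lp_bound p g n"
  shows "Lp_bound p (\<lambda>x. f x - g x) (4 * (m + n))"
proof -
  note [measurable] = Lp_boundD(1)[OF f] Lp_boundD(1)[OF g]
  note mn = Lp_boundD(2)[OF f] Lp_boundD(2)[OF g]
  have "(\<integral>\<^sup>+x. ennreal (norm (f x - g x) powr p) \<partial>lborel)
    \<le> (\<integral>\<^sup>+x. ennreal (2 powr p) * (ennreal (norm (f x) powr p) + ennreal (norm (g x) powr p)) \<partial>lborel)"
  proof (rule nn_integral_mono)
    fix x
    have "norm (f x - g x) powr p \<le> (norm (f x) + norm (g x)) powr p"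
      using p by (intro powr_mono2 norm_triangle_ineq4) auto
    also have "\<dots> \<le> 2 powr p * (norm (f x) powr p + norm (g x) powr p)"
      using p by (intro powr_add_le) auto
    finally show "ennreal (norm (f x - g x) powr p)
        \<le> ennreal (2 powr p) * (ennreal (norm (f x) powr p) + ennreal (norm (g x) powr p))"
      by (simp add: ennreal_mult[symmetric] ennreal_plus[symmetric] ennreal_leI del: ennreal_plus)
  qed
  also have "\<dots> = ennreal (2 powr p) * ((\<integral>\<^sup>+x. ennreal (norm (f x) powr p) \<partial>lborel)
      + (\<integral>\<^sup>+x. ennreal (norm (g x) powr p) \<partial>lborel))"
    by (simp add: nn_integral_cmult nn_integral_add)
  also have "\<dots> \<le> ennreal (2 powr p) * (ennreal (m powr p) + ennreal (n powr p))"
    by (intro mult_left_mono add_mono Lp_boundD[OF f] Lp_boundD[OF g]) auto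
  also have "\<dots> = ennreal (2 powr p * (m powr p + n powr p))"
    by (simp add: ennreal_mult[symmetric] ennreal_plus[symmetric] del: ennreal_plus)
  also have "\<dots> \<le> ennreal ((4 * (m + n)) powr p)"
  proof (rule ennreal_leI)
    have "m powr p + n powr p \<le> 2 powr 1 * (m + n) powr p"
      using powr_mono2[of p m "m + n"] powr_mono2[of p n "m + n"] mn p by simp
    also have "\<dots> \<le> 2 powr p * (m + n) powr p"
      using p by (intro mult_right_mono powr_mono) auto
    finally have "2 powr p * (m powr p + n powr p) \<le> 2 powr p * (2 powr p * (m + n) powr p)"
      by (intro mult_left_mono) auto
    also have "\<dots> = (4 * (m + n)) powr p"
      using mn by (simp add: powr_mult[symmetric])
    finally show "2 powr p * (m powr p + n powr p) \<le> (4 * (m + n)) powr p" .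
  qed
  finally show ?thesis using mn by (simp add: Lp_bound_def)
qed

text \<open>Hoelder's inequality on a set of measure at most \<open>s\<close>, as an instance of
  \<open>weighted_power_mean\<close> with the weight \<open>indicator S x / s\<close>, whose total
  mass is at most 1.\<close>

lemma nn_integral_set_norm_le:
  fixes f :: "'a::euclidean_space \<Rightarrow> 'b::{banach, second_countable_topology}"
  assumes p: "1 < p" and f: "Lp_bound p f m"
    and [measurable]: "S \<in> sets borel" and S: "emeasure lborel S \<le> ennreal s" and s: "0 < s"
  shows "(\<integral>\<^sup>+x\<in>S. ennreal (norm (f x)) \<partial>lborel) \<le> ennreal (s powr (1 - 1 / p) * m)"
proof -
  note [measurable] = Lp_boundD(1)[OF f]
  note m = Lp_boundD(2)[OF f]
  have "(\<integral>\<^sup>+x. ennreal (norm (f x) * (indicator S x / s)) \<partial>lborel) \<le> ennreal (s powr (- (1 / p)) * m)"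
  proof (rule weighted_power_mean[OF p])
    have "(\<integral>\<^sup>+x. ennreal (indicator S x / s) \<partial>lborel) = (\<integral>\<^sup>+x. ennreal (1 / s) * indicator S x \<partial>lborel)"
      by (intro nn_integral_cong) (auto split: split_indicator)
    also have "\<dots> = ennreal (1 / s) * emeasure lborel S"
      by (simp add: nn_integral_cmult)
    also have "\<dots> \<le> ennreal (1 / s) * ennreal s"
      by (intro mult_left_mono S) auto
    also have "\<dots> = 1" using s by (simp add: ennreal_mult[symmetric])
    finally show "(\<integral>\<^sup>+x. ennreal (indicator S x / s) \<partial>lborel) \<le> 1" .
    have "(\<integral>\<^sup>+x. ennreal (norm (f x) powr p * (indicator S x / s)) \<partial>lborel)
      \<le> (\<integral>\<^sup>+x. ennreal (1 / s) * ennreal (norm (f x) powr p) \<partial>lborel)"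
      using s by (intro nn_integral_mono) (auto simp: ennreal_mult[symmetric] split: split_indicator)
    also have "\<dots> \<le> ennreal (1 / s) * ennreal (m powr p)"
      by (subst nn_integral_cmult) (auto intro!: mult_left_mono Lp_boundD[OF f])
    also have "\<dots> = ennreal ((s powr (- (1 / p)) * m) powr p)"
      using p s m by (simp add: ennreal_mult[symmetric] powr_mult powr_divide powr_powr powr_minus_divide)
    finally show "(\<integral>\<^sup>+x. ennreal (norm (f x) powr p * (indicator S x / s)) \<partial>lborel)
      \<le> ennreal ((s powr (- (1 / p)) * m) powr p)" .
  qed (use s m in auto)
  then have "ennreal s * (\<integral>\<^sup>+x. ennreal (norm (f x) * (indicator S x / s)) \<partial>lborel)
      \<le> ennreal s * ennreal (s powr (- (1 / p)) * m)"
    by (rule mult_left_mono) auto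
  also have "ennreal s * (\<integral>\<^sup>+x. ennreal (norm (f x) * (indicator S x / s)) \<partial>lborel)
      = (\<integral>\<^sup>+x\<in>S. ennreal (norm (f x)) \<partial>lborel)"
    using s by (subst nn_integral_cmult[symmetric])
      (auto intro!: nn_integral_cong simp: ennreal_mult[symmetric] split: split_indicator)
  also have "ennreal s * ennreal (s powr (- (1 / p)) * m) = ennreal (s powr (1 - 1 / p) * m)"
    using s m by (simp add: ennreal_mult[symmetric] powr_diff powr_minus divide_inverse)
  finally show ?thesis .
qed

text \<open>Jensen's inequality for the \<open>p\<close>-th power. If the right side is a finite
  number \<open>j\<close>, then \<open>weighted_power_mean\<close> applies with
  \<open>m = j powr (1 / p)\<close>.\<close>

lemma norm_integral_powr_le:
  fixes g :: "'a \<Rightarrow> 'b::{banach, second_countable_topology}" and w :: "'a \<Rightarrow> real"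
  assumes p: "1 < p" and [measurable]: "g \<in> borel_measurable M" "w \<in> borel_measurable M"
    and w: "\<And>x. 0 \<le> w x" "(\<integral>\<^sup>+x. ennreal (w x) \<partial>M) \<le> 1"
  shows "ennreal (norm (\<integral>x. w x *\<^sub>R g x \<partial>M) powr p) \<le> (\<integral>\<^sup>+x. ennreal (norm (g x) powr p * w x) \<partial>M)"
proof (cases "\<integral>\<^sup>+x. ennreal (norm (g x) powr p * w x) \<partial>M")
  case (real j)
  have "(\<integral>\<^sup>+x. ennreal (norm (g x) * w x) \<partial>M) \<le> ennreal (j powr (1 / p))"
  proof (rule weighted_power_mean[OF p])
    show "(\<integral>\<^sup>+x. ennreal (norm (g x) powr p * w x) \<partial>M) \<le> ennreal ((j powr (1 / p)) powr p)"
      using p real by (simp add: powr_powr)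
  qed (use w in simp_all)
  moreover have "ennreal (norm (\<integral>x. w x *\<^sub>R g x \<partial>M)) \<le> (\<integral>\<^sup>+x. ennreal (norm (g x) * w x) \<partial>M)"
  proof (cases "integrable M (\<lambda>x. w x *\<^sub>R g x)")
    case True
    then have "ennreal (norm (\<integral>x. w x *\<^sub>R g x \<partial>M)) \<le> (\<integral>\<^sup>+x. ennreal (norm (w x *\<^sub>R g x)) \<partial>M)"
      by (rule integral_norm_bound_ennreal)
    also have "\<dots> = (\<integral>\<^sup>+x. ennreal (norm (g x) * w x) \<partial>M)"
      by (simp add: w(1) mult.commute)
    finally show ?thesis .
  \<comment> \<open>Without integrability the Bochner integral has the default value 0, and the
    estimate is trivial.\<close>
  qed (simp add: not_integrable_integral_eq)
  ultimately have "ennreal (norm (\<integral>x. w x *\<^sub>R g x \<partial>M)) \<le> ennreal (j powr (1 / p))"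
    by (rule order_trans[rotated])
  then have "norm (\<integral>x. w x *\<^sub>R g x \<partial>M) \<le> j powr (1 / p)"
    by simp
  then have "norm (\<integral>x. w x *\<^sub>R g x \<partial>M) powr p \<le> (j powr (1 / p)) powr p"
    using p by (intro powr_mono2) auto
  then show ?thesis unfolding real(2) using real(1) p by (simp add: powr_powr)
qed simp

lemma integral_lborel_affine:
  fixes f :: "'a::euclidean_space \<Rightarrow> 'b::{banach, second_countable_topology}"
  assumes [measurable]: "f \<in> borel_measurable borel" and "c \<noteq> 0"
  shows "(\<integral>x. f x \<partial>lborel) = (\<bar>c\<bar> ^ DIM('a)) *\<^sub>R (\<integral>x. f (t + c *\<^sub>R x) \<partial>lborel)"
  by (subst lborel_affine[OF \<open>c \<noteq> 0\<close>, of t])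
     (simp add: integral_density integral_distr)

section \<open>The tent kernel and averages against it\<close>

definition tent_mass :: "'a::euclidean_space itself \<Rightarrow> real" where
  "tent_mass _ = enn2real (\<integral>\<^sup>+x. ennreal (max 0 (1 - norm x)) \<partial>(lborel :: 'a measure))"

text \<open>A normalised tent is smooth enough: the estimates use only that it is nonnegative,
  bounded and Lipschitz, has integral 1 and vanishes outside the unit ball.\<close>

definition bump :: "'a::euclidean_space \<Rightarrow> real" where
  "bump x = max 0 (1 - norm x) / tent_mass TYPE('a)"

lemma tent_mass:
  "0 < tent_mass TYPE('a::euclidean_space)"
  "(\<integral>\<^sup>+x. ennreal (max 0 (1 - norm x)) \<partial>(lborel :: 'a measure)) = ennreal (tent_mass TYPE('a))"
proof -
  let ?I = "\<integral>\<^sup>+x. ennreal (max 0 (1 - norm x)) \<partial>(lborel :: 'a measure)"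
  have "?I \<le> (\<integral>\<^sup>+x. indicator (cball (0::'a) 1) x \<partial>lborel)"
    by (intro nn_integral_mono) (auto split: split_indicator)
  also have "\<dots> < top"
    using emeasure_bounded_finite[of "cball (0::'a) 1"] by simp
  finally have fin: "?I < top" .
  have "0 < ennreal (1 / 2) * emeasure lborel (cball (0::'a) (1 / 2))"
    by (simp add: emeasure_cball ennreal_zero_less_mult_iff del: ennreal_half)
  also have "\<dots> = (\<integral>\<^sup>+x. ennreal (1 / 2) * indicator (cball (0::'a) (1 / 2)) x \<partial>lborel)"
    by (rule nn_integral_cmult_indicator[symmetric]) simp
  also have "\<dots> \<le> ?I"
  proof (rule nn_integral_mono)
    fix x :: 'a
    have "ennreal (1 / 2) \<le> ennreal (max 0 (1 - norm x))" if "x \<in> cball 0 (1 / 2)"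
      by (rule ennreal_leI) (use that in auto)
    then show "ennreal (1 / 2) * indicator (cball 0 (1 / 2)) x \<le> ennreal (max 0 (1 - norm x))"
      by (simp split: split_indicator)
  qed
  finally show "0 < tent_mass TYPE('a)" "?I = ennreal (tent_mass TYPE('a))"
    using fin by (auto simp: tent_mass_def enn2real_positive_iff)
qed

lemma bump_nonneg: "0 \<le> bump x"
  using tent_mass(1)[where 'a='a] by (simp add: bump_def)

lemma bump_eq_0: "1 \<le> norm x \<Longrightarrow> bump x = 0"
  by (simp add: bump_def)

lemma bump_le: "bump (x::'a::euclidean_space) \<le> 1 / tent_mass TYPE('a)"
  using tent_mass(1)[where 'a='a] by (simp add: bump_def divide_right_mono)

lemma bump_measurable [measurable]: "bump \<in> borel_measurable borel"
  unfolding bump_def by measurable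

lemma nn_integral_bump: "(\<integral>\<^sup>+x. ennreal (bump x) \<partial>(lborel :: 'a::euclidean_space measure)) = 1"
proof -
  have "(\<integral>\<^sup>+x. ennreal (bump x) \<partial>(lborel :: 'a measure))
      = (\<integral>\<^sup>+x. ennreal (1 / tent_mass TYPE('a)) * ennreal (max 0 (1 - norm x)) \<partial>(lborel :: 'a measure))"
    using tent_mass(1)[where 'a='a]
    by (intro nn_integral_cong) (simp add: bump_def ennreal_mult[symmetric])
  also have "\<dots> = ennreal (1 / tent_mass TYPE('a)) * ennreal (tent_mass TYPE('a))"
    by (subst nn_integral_cmult) (auto simp: tent_mass(2))
  also have "\<dots> = 1"
    using tent_mass(1)[where 'a='a] by (simp add: ennreal_mult[symmetric])
  finally show ?thesis .
qed

lemma integrable_bump: "integrable lborel (bump :: 'a::euclidean_space \<Rightarrow> real)"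
  by (intro integrableI_nonneg) (auto simp: bump_nonneg nn_integral_bump)

lemma integral_bump: "(\<integral>x. bump x \<partial>(lborel :: 'a::euclidean_space measure)) = 1"
  by (subst integral_eq_nn_integral) (auto simp: bump_nonneg nn_integral_bump)

lemma bump_lipschitz: "\<bar>bump x - bump y\<bar> \<le> norm (x - y) / tent_mass TYPE('a)"
  for x y :: "'a::euclidean_space"
proof -
  have "\<bar>bump x - bump y\<bar> = \<bar>max 0 (1 - norm x) - max 0 (1 - norm y)\<bar> / tent_mass TYPE('a)"
    using tent_mass(1)[where 'a='a] by (simp add: bump_def diff_divide_distrib[symmetric])
  also have "\<dots> \<le> norm (x - y) / tent_mass TYPE('a)"
    using tent_mass(1)[where 'a='a] norm_triangle_ineq3[of x y]
    by (intro divide_right_mono) linarith+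
  finally show ?thesis .
qed

text \<open>Since \<open>bump\<close> is even, for \<open>0 < a\<close> this is the convolution of
  \<open>f\<close> with the kernel \<open>bump\<close> rescaled to the ball of radius
  \<open>a\<close>. Here the variable \<open>y\<close> stays in the unit ball, so that the same
  \<open>y\<close> can be used at all scales when finite differences are averaged.\<close>

definition mollify :: "real \<Rightarrow> ('a::euclidean_space \<Rightarrow> 'b::{banach, second_countable_topology}) \<Rightarrow> 'a \<Rightarrow> 'b" where
  "mollify a f x = (\<integral>y. bump y *\<^sub>R f (x + a *\<^sub>R y) \<partial>lborel)"

lemma mollify_measurable:
  assumes [measurable]: "f \<in> borel_measurable borel"
  shows "mollify a f \<in> borel_measurable borel"
  unfolding mollify_def by measurable

context
  fixes f :: "'a::euclidean_space \<Rightarrow> 'b::{banach, second_countable_topology}" and p m a :: real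
  assumes p: "1 < p" and f: "Lp_bound p f m" and a: "0 < a"
begin

lemma integrable_mollify: "integrable lborel (\<lambda>y. bump y *\<^sub>R f (x + a *\<^sub>R y))"
proof -
  note [measurable] = Lp_boundD(1)[OF f]
  note m = Lp_boundD(2)[OF f]
  let ?g = "\<lambda>y. norm (f (x + a *\<^sub>R y))"
  define q where "q = 1 / tent_mass TYPE('a) * (1 / a ^ DIM('a) * m powr p)"
  have q: "0 \<le> q" using m a tent_mass(1)[where 'a='a] by (simp add: q_def)
  have "ennreal (a ^ DIM('a)) * (\<integral>\<^sup>+y. ennreal (?g y powr p) \<partial>lborel) \<le> ennreal (m powr p)"
    using Lp_boundD(3)[OF f] a nn_integral_lborel_affine[of "\<lambda>y. ennreal (norm (f y) powr p)" a x] by simp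
  then have "ennreal (1 / a ^ DIM('a)) * (ennreal (a ^ DIM('a)) * (\<integral>\<^sup>+y. ennreal (?g y powr p) \<partial>lborel))
      \<le> ennreal (1 / a ^ DIM('a)) * ennreal (m powr p)"
    by (rule mult_left_mono) auto
  also have "ennreal (1 / a ^ DIM('a)) * (ennreal (a ^ DIM('a)) * (\<integral>\<^sup>+y. ennreal (?g y powr p) \<partial>lborel))
      = (\<integral>\<^sup>+y. ennreal (?g y powr p) \<partial>lborel)"
    using a by (subst mult.assoc[symmetric], subst ennreal_mult[symmetric]) auto
  also have "ennreal (1 / a ^ DIM('a)) * ennreal (m powr p) = ennreal (1 / a ^ DIM('a) * m powr p)"
    using a by (intro ennreal_mult[symmetric]) auto
  finally have *: "(\<integral>\<^sup>+y. ennreal (?g y powr p) \<partial>lborel) \<le> ennreal (1 / a ^ DIM('a) * m powr p)" .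
  have "(\<integral>\<^sup>+y. ennreal (?g y powr p * bump y) \<partial>lborel)
    \<le> (\<integral>\<^sup>+y. ennreal (1 / tent_mass TYPE('a)) * ennreal (?g y powr p) \<partial>lborel)"
  proof (rule nn_integral_mono)
    fix y
    have "?g y powr p * bump y \<le> ?g y powr p * (1 / tent_mass TYPE('a))"
      by (intro mult_left_mono bump_le) auto
    then show "ennreal (?g y powr p * bump y) \<le> ennreal (1 / tent_mass TYPE('a)) * ennreal (?g y powr p)"
      using tent_mass(1)[where 'a='a] by (simp add: ennreal_mult[symmetric] ennreal_leI)
  qed
  also have "\<dots> \<le> ennreal (1 / tent_mass TYPE('a)) * ennreal (1 / a ^ DIM('a) * m powr p)"
    by (subst nn_integral_cmult, simp, rule mult_left_mono[OF *]) simp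
  also have "\<dots> = ennreal q"
    using m a tent_mass(1)[where 'a='a] by (simp add: q_def ennreal_mult[symmetric])
  also have "q = (q powr (1 / p)) powr p"
    using p q by (simp add: powr_powr)
  finally have "(\<integral>\<^sup>+y. ennreal (?g y * bump y) \<partial>lborel) \<le> ennreal (q powr (1 / p))"
    by (rule weighted_power_mean[OF p, rotated -1]) (simp_all add: bump_nonneg nn_integral_bump)
  also have "\<dots> < \<infinity>" by simp
  finally show ?thesis
    by (intro integrableI_bounded) (auto simp: bump_nonneg mult.commute)
qed

text \<open>Substituting \<open>z = x + a *\<^sub>R y\<close> moves the dependence on the point from
  \<open>f\<close> to the kernel. The two kernels differ by at most \<open>c\<close> and only on the
  union \<open>S\<close> of two balls of radius \<open>a\<close>, so Hoelder on \<open>S\<close>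
  applies. The powers of \<open>a\<close> are \<open>- d\<close> from the substitution,
  \<open>- 1\<close> from the slope of the kernel and \<open>d * (1 - 1 / p)\<close> from the
  measure of \<open>S\<close>, where \<open>d = DIM('a)\<close>.\<close>

lemma mollify_lipschitz:
  "norm (mollify a f x - mollify a f x')
    \<le> (2 * unit_ball_vol (real DIM('a))) powr (1 - 1 / p) / tent_mass TYPE('a)
        * a powr (- 1 - DIM('a) / p) * m * norm (x - x')"
proof -
  note [measurable] = Lp_boundD(1)[OF f]
  note m = Lp_boundD(2)[OF f]
  note t = tent_mass(1)[where 'a='a]
  define V where "V = unit_ball_vol (real DIM('a))"
  have V: "0 < V" by (simp add: V_def)
  define w where "w = (\<lambda>(x::'a) z. bump ((z - x) /\<^sub>R a))"
  have [measurable]: "w x \<in> borel_measurable borel" for x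
    unfolding w_def by measurable
  have shift: "mollify a f x = (1 / a ^ DIM('a)) *\<^sub>R (\<integral>z. w x z *\<^sub>R f z \<partial>lborel)" for x
    using a by (subst integral_lborel_affine[of _ a x]) (auto simp: w_def mollify_def)
  have int: "integrable lborel (\<lambda>z. w x z *\<^sub>R f z)" for x
  proof -
    have "integrable (density (distr lborel borel (\<lambda>y. x + a *\<^sub>R y)) (\<lambda>_. \<bar>a\<bar> ^ DIM('a))) (\<lambda>z. w x z *\<^sub>R f z)"
      using a integrable_mollify[of x]
      by (subst integrable_density)
         (auto simp: integrable_distr_eq w_def, simp add: scaleR_scaleR[symmetric] del: scaleR_scaleR)
    then show ?thesis using a by (subst lborel_affine[of a x]) auto
  qed
  define S where "S = cball x a \<union> cball x' a"
  have [measurable]: "S \<in> sets borel" by (simp add: S_def)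
  have S: "emeasure lborel S \<le> ennreal (2 * V * a ^ DIM('a))"
  proof -
    have "emeasure lborel S \<le> emeasure lborel (cball x a) + emeasure lborel (cball x' a)"
      unfolding S_def by (intro emeasure_subadditive) auto
    also have "\<dots> = ennreal (2 * V * a ^ DIM('a))"
      using a V by (simp add: emeasure_cball V_def[symmetric] ennreal_plus[symmetric] del: ennreal_plus)
    finally show ?thesis .
  qed
  define c where "c = norm (x - x') / a / tent_mass TYPE('a)"
  have c: "0 \<le> c" using a t by (simp add: c_def)
  have w: "\<bar>w x z - w x' z\<bar> \<le> c * indicator S z" for z
  proof (cases "z \<in> S")
    case True
    have "\<bar>w x z - w x' z\<bar> \<le> norm ((z - x) /\<^sub>R a - (z - x') /\<^sub>R a) / tent_mass TYPE('a)"
      unfolding w_def by (rule bump_lipschitz)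
    also have "(z - x) /\<^sub>R a - (z - x') /\<^sub>R a = (x' - x) /\<^sub>R a"
      by (simp add: scaleR_diff_right)
    also have "norm \<dots> / tent_mass TYPE('a) = c"
      using a by (simp add: c_def norm_minus_commute divide_inverse mult.commute)
    finally show ?thesis using True by simp
  next
    case False
    then have "a \<le> norm (z - x)" "a \<le> norm (z - x')"
      by (auto simp: S_def dist_norm norm_minus_commute)
    then have "w x z = 0" "w x' z = 0"
      using a unfolding w_def by (intro bump_eq_0; unfold norm_scaleR; simp add: field_simps)+
    then show ?thesis using False by simp
  qed
  have "norm (\<integral>z. (w x z - w x' z) *\<^sub>R f z \<partial>lborel) \<le> c * ((2 * V * a ^ DIM('a)) powr (1 - 1 / p) * m)"
  proof -
    have "ennreal (norm (\<integral>z. (w x z - w x' z) *\<^sub>R f z \<partial>lborel))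
        \<le> (\<integral>\<^sup>+z. ennreal (norm ((w x z - w x' z) *\<^sub>R f z)) \<partial>lborel)"
      using int by (intro integral_norm_bound_ennreal) (auto simp: scaleR_diff_left)
    also have "\<dots> \<le> (\<integral>\<^sup>+z. ennreal c * (ennreal (norm (f z)) * indicator S z) \<partial>lborel)"
    proof (rule nn_integral_mono)
      fix z
      have "norm ((w x z - w x' z) *\<^sub>R f z) \<le> c * indicator S z * norm (f z)"
        using w[of z] by (auto intro: mult_right_mono)
      then have "ennreal (norm ((w x z - w x' z) *\<^sub>R f z)) \<le> ennreal (c * indicator S z * norm (f z))"
        by (rule ennreal_leI)
      also have "\<dots> = ennreal c * (ennreal (norm (f z)) * indicator S z)"
        using c by (auto simp: ennreal_mult split: split_indicator)
      finally show "ennreal (norm ((w x z - w x' z) *\<^sub>R f z)) \<le> ennreal c * (ennreal (norm (f z)) * indicator S z)" .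
    qed
    also have "\<dots> = ennreal c * (\<integral>\<^sup>+z\<in>S. ennreal (norm (f z)) \<partial>lborel)"
      by (rule nn_integral_cmult) simp
    also have "\<dots> \<le> ennreal c * ennreal ((2 * V * a ^ DIM('a)) powr (1 - 1 / p) * m)"
      using a V by (intro mult_left_mono nn_integral_set_norm_le[OF p f _ S]) auto
    also have "\<dots> = ennreal (c * ((2 * V * a ^ DIM('a)) powr (1 - 1 / p) * m))"
      using c m by (simp add: ennreal_mult)
    finally show ?thesis using c m by simp
  qed
  then have "1 / a ^ DIM('a) * norm (\<integral>z. (w x z - w x' z) *\<^sub>R f z \<partial>lborel)
      \<le> 1 / a ^ DIM('a) * (c * ((2 * V * a ^ DIM('a)) powr (1 - 1 / p) * m))"
    using a by (intro mult_left_mono) auto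
  moreover have "mollify a f x - mollify a f x' = (1 / a ^ DIM('a)) *\<^sub>R (\<integral>z. (w x z - w x' z) *\<^sub>R f z \<partial>lborel)"
    by (simp add: shift scaleR_diff_left int scaleR_diff_right)
  ultimately have "norm (mollify a f x - mollify a f x')
      \<le> 1 / a ^ DIM('a) * (c * ((2 * V * a ^ DIM('a)) powr (1 - 1 / p) * m))"
    using a by simp
  also have "(2 * V * a ^ DIM('a)) powr (1 - 1 / p)
      = (2 * V) powr (1 - 1 / p) * (a ^ DIM('a) * a powr (- (DIM('a) / p)))"
  proof -
    have "(a ^ DIM('a)) powr (1 - 1 / p) = a powr (DIM('a) + - (DIM('a) / p))"
      using a by (simp add: powr_realpow[symmetric] powr_powr right_diff_distrib)
    also have "\<dots> = a ^ DIM('a) * a powr (- (DIM('a) / p))"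
      using a by (simp only: powr_add powr_realpow)
    finally show ?thesis using V a by (simp only: powr_mult)
  qed
  also have "1 / a ^ DIM('a) * (c * ((2 * V) powr (1 - 1 / p) * (a ^ DIM('a) * a powr (- (DIM('a) / p))) * m))
      = (2 * V) powr (1 - 1 / p) / tent_mass TYPE('a) * (a powr (- (DIM('a) / p)) / a) * m * norm (x - x')"
    using a by (simp add: c_def mult_ac)
  also have "a powr (- (DIM('a) / p)) / a = a powr (- 1 - DIM('a) / p)"
  proof -
    have "a powr (- (DIM('a) / p) - 1) = a powr (- (DIM('a) / p)) / a"
      using a by (simp add: powr_diff)
    moreover have "- (DIM('a) / p) - 1 = - 1 - DIM('a) / p" by simp
    ultimately show ?thesis by metis
  qed
  finally show ?thesis by (simp add: V_def)
qed

text \<open>An average of translates of \<open>f\<close> keeps the Lipschitz constant of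
  \<open>f\<close>. A second smoothing therefore loses only the sum of the binomial
  coefficients.\<close>

lemma mollify_lipschitz_transfer:
  assumes L: "\<And>x y. norm (f x - f y) \<le> L * norm (x - y)"
  shows "norm (mollify a f x - mollify a f x') \<le> L * norm (x - x')"
proof -
  have "norm (mollify a f x - mollify a f x')
      = norm (\<integral>y. bump y *\<^sub>R (f (x + a *\<^sub>R y) - f (x' + a *\<^sub>R y)) \<partial>lborel)"
    by (simp add: mollify_def scaleR_diff_right integrable_mollify)
  also have "\<dots> \<le> (\<integral>y. bump (y::'a) * (L * norm (x - x')) \<partial>lborel)"
  proof (rule Bochner_Integration.integral_norm_bound_integral)
    show "integrable lborel (\<lambda>y. bump y *\<^sub>R (f (x + a *\<^sub>R y) - f (x' + a *\<^sub>R y)))"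
      by (simp add: scaleR_diff_right integrable_mollify)
    show "integrable lborel (\<lambda>y::'a. bump y * (L * norm (x - x')))"
      by (simp add: integrable_bump)
    show "norm (bump y *\<^sub>R (f (x + a *\<^sub>R y) - f (x' + a *\<^sub>R y))) \<le> bump y * (L * norm (x - x'))" for y
      using L[of "x + a *\<^sub>R y" "x' + a *\<^sub>R y"] by (simp add: bump_nonneg mult_left_mono)
  qed
  also have "\<dots> = L * norm (x - x')"
    by (simp add: integral_bump)
  finally show ?thesis .
qed

end

subsection \<open>Smoothing adapted to differences of order \<open>k\<close>\<close>

lemma mollify_add:
  fixes f g :: "'a::euclidean_space \<Rightarrow> 'b::{banach, second_countable_topology}"
  assumes "1 < p" "Lp_bound p f m" "Lp_bound p g n" "0 < a"
  shows "mollify a (\<lambda>x. f x + g x) x = mollify a f x + mollify a g x"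
  using assms by (simp add: mollify_def scaleR_add_right integrable_mollify)

lemma Lp_bound_translation:
  fixes f :: "'a::euclidean_space \<Rightarrow> 'b::{banach, second_countable_topology}"
  assumes "Lp_bound p f m"
  shows "Lp_bound p (\<lambda>x. f (x + h)) m"
proof -
  note [measurable] = Lp_boundD(1)[OF assms]
  show ?thesis
    using assms nn_integral_lborel_translation[of "\<lambda>x. ennreal (norm (f x) powr p)" h]
    by (simp add: Lp_bound_def)
qed

lemma Lp_bound_difference:
  fixes f :: "real ^ 'n \<Rightarrow> 'b::{banach, second_countable_topology}"
  assumes "1 < p" "Lp_bound p f m"
  shows "Lp_bound p ((difference h ^^ k) f) (8 ^ k * m)"
proof (induction k)
  case (Suc k)
  from Lp_bound_diff[OF assms(1) Lp_bound_translation[OF Suc, of h] Suc]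
  moreover have "(difference h ^^ Suc k) f = (\<lambda>x. (difference h ^^ k) f (x + h) - (difference h ^^ k) f x)"
    by (simp add: difference_def[of h "(difference h ^^ k) f"])
  ultimately show ?case by (simp add: mult_ac)
qed (use assms in simp)

lemma difference_expansion:
  fixes f :: "real ^ 'n \<Rightarrow> 'b::real_normed_vector"
  shows "(difference h ^^ k) f x =
    (\<Sum>i\<le>k. ((-1) ^ (k + i) * real (k choose i)) *\<^sub>R f (x + real i *\<^sub>R h))"
proof (induction k arbitrary: x)
  case (Suc k)
  define s :: "nat \<Rightarrow> nat \<Rightarrow> real" where "s = (\<lambda>k i. (-1) ^ (k + i) * real (k choose i))"
  have s: "s (Suc k) (Suc i) = s k i - s k (Suc i)" for i
    by (simp add: s_def algebra_simps)
  have s0: "s (Suc k) 0 = - s k 0"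
    by (simp add: s_def)
  have sk: "s k (Suc k) = 0"
    by (simp add: s_def)
  have shift: "f (x + h + real i *\<^sub>R h) = f (x + real (Suc i) *\<^sub>R h)" for i
    by (simp add: algebra_simps)
  have "(difference h ^^ Suc k) f x
      = (\<Sum>i\<le>k. s k i *\<^sub>R f (x + real (Suc i) *\<^sub>R h)) - (\<Sum>i\<le>k. s k i *\<^sub>R f (x + real i *\<^sub>R h))"
    by (simp only: funpow.simps comp_apply difference_def Suc.IH s_def shift)
  \<comment> \<open>The added term vanishes because \<open>k choose Suc k = 0\<close>; splitting off
    \<open>i = 0\<close> then aligns the two sums for Pascal's rule.\<close>
  also have "(\<Sum>i\<le>k. s k i *\<^sub>R f (x + real i *\<^sub>R h)) = (\<Sum>i\<le>Suc k. s k i *\<^sub>R f (x + real i *\<^sub>R h))"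
    by (simp add: sk)
  also have "\<dots> = s k 0 *\<^sub>R f x + (\<Sum>i\<le>k. s k (Suc i) *\<^sub>R f (x + real (Suc i) *\<^sub>R h))"
    by (subst sum.atMost_Suc_shift) simp
  also have "(\<Sum>i\<le>k. s k i *\<^sub>R f (x + real (Suc i) *\<^sub>R h))
      - (s k 0 *\<^sub>R f x + (\<Sum>i\<le>k. s k (Suc i) *\<^sub>R f (x + real (Suc i) *\<^sub>R h)))
      = s (Suc k) 0 *\<^sub>R f x + (\<Sum>i\<le>k. s (Suc k) (Suc i) *\<^sub>R f (x + real (Suc i) *\<^sub>R h))"
    by (simp add: s s0 scaleR_diff_left sum_subtractf)
  also have "\<dots> = (\<Sum>i\<le>Suc k. s (Suc k) i *\<^sub>R f (x + real i *\<^sub>R h))"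
    by (subst sum.atMost_Suc_shift) simp
  finally show ?case by (simp only: s_def)
qed simp

text \<open>
  The coefficients are those of the \<open>k\<close>-th difference, so that the error \<open>f - smoothing k t f\<close>
  is an average of the differences \<open>\<Delta>\<^sub>h\<^sup>k f\<close> with \<open>|h| \<le> t\<close>.
\<close>

definition smoothing ::
  "nat \<Rightarrow> real \<Rightarrow> ('a::euclidean_space \<Rightarrow> 'b::{banach, second_countable_topology}) \<Rightarrow> 'a \<Rightarrow> 'b" where
  "smoothing k t f x = (\<Sum>i=1..k. ((-1) ^ Suc i * real (k choose i)) *\<^sub>R mollify (real i * t) f x)"

lemma smoothing_add:
  fixes f g :: "'a::euclidean_space \<Rightarrow> 'b::{banach, second_countable_topology}"
  assumes "1 < p" "Lp_bound p f m" "Lp_bound p g n" "0 < t"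
  shows "smoothing k t (\<lambda>x. f x + g x) x = smoothing k t f x + smoothing k t g x"
  unfolding smoothing_def sum.distrib[symmetric]
  by (intro sum.cong refl) (use assms in \<open>simp add: mollify_add scaleR_add_right\<close>)

text \<open>In the binomial expansion of the difference the node \<open>i = 0\<close> does not
  depend on \<open>y\<close> and averages to a multiple of \<open>f x\<close>, as
  \<open>bump\<close> has integral 1. Each node with \<open>1 \<le> i\<close> averages to a
  mollification at scale \<open>real i * t\<close>.\<close>

lemma diff_smoothing_eq:
  fixes f :: "real ^ 'n \<Rightarrow> 'b::{banach, second_countable_topology}"
  assumes "1 < p" "Lp_bound p f m" "0 < t"
  shows "f x - smoothing k t f x = ((-1) ^ k) *\<^sub>R (\<integral>y. bump y *\<^sub>R (difference (t *\<^sub>R y) ^^ k) f x \<partial>lborel)"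
proof -
  let ?s = "\<lambda>i. (-1) ^ (k + i) * real (k choose i)"
  let ?g = "\<lambda>i y. ?s i *\<^sub>R (bump y *\<^sub>R f (x + (real i * t) *\<^sub>R y))"
  have int: "integrable lborel (?g i)" for i
  proof (cases "i = 0")
    case True
    then show ?thesis by (simp add: integrable_bump)
  next
    case False
    then show ?thesis
      using assms by (intro integrable_scaleR_right integrable_mollify[of p f m]) auto
  qed
  have val: "(\<integral>y. ?g i y \<partial>lborel) = ?s i *\<^sub>R (if i = 0 then f x else mollify (real i * t) f x)" for i
    unfolding integral_scaleR_right
    by (cases "i = 0") (simp_all add: mollify_def integral_bump integral_scaleR_left[OF integrable_bump])
  have "(\<integral>y. bump y *\<^sub>R (difference (t *\<^sub>R y) ^^ k) f x \<partial>lborel) = (\<integral>y. (\<Sum>i\<le>k. ?g i y) \<partial>lborel)"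
    by (intro Bochner_Integration.integral_cong refl)
       (simp add: difference_expansion scaleR_sum_right mult_ac)
  also have "\<dots> = (\<Sum>i\<le>k. \<integral>y. ?g i y \<partial>lborel)"
    using int by (intro Bochner_Integration.integral_sum) auto
  also have "\<dots> = (\<Sum>i\<le>k. ?s i *\<^sub>R (if i = 0 then f x else mollify (real i * t) f x))"
    by (simp only: val)
  also have "\<dots> = ?s 0 *\<^sub>R f x + (\<Sum>i=1..k. ?s i *\<^sub>R mollify (real i * t) f x)"
    by (simp add: atMost_atLeast0 sum.atLeast_Suc_atMost)
  finally have eq: "(\<integral>y. bump y *\<^sub>R (difference (t *\<^sub>R y) ^^ k) f x \<partial>lborel)
      = ?s 0 *\<^sub>R f x + (\<Sum>i=1..k. ?s i *\<^sub>R mollify (real i * t) f x)" .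
  have one: "(-1) ^ k * ((-1) ^ (k + i) * c) = - ((-1) ^ Suc i * c)" for i and c :: real
    by (simp add: power_add mult.assoc[symmetric] power_mult_distrib[symmetric])
  show ?thesis
    unfolding eq scaleR_add_right scaleR_sum_right scaleR_scaleR one
    by (simp add: smoothing_def sum_negf)
qed

text \<open>Jensen's inequality in \<open>y\<close> followed by Fubini keeps the constant equal to
  1. Only steps \<open>t *\<^sub>R y\<close> with \<open>norm y < 1\<close> count, because
  \<open>bump\<close> vanishes elsewhere.\<close>

lemma Lp_bound_diff_smoothing:
  fixes f :: "real ^ 'n \<Rightarrow> 'b::{banach, second_countable_topology}"
  assumes p: "1 < p" and f: "Lp_bound p f m" and t: "0 < t" and w: "0 \<le> w"
    and h: "\<And>h. norm h \<le> t \<Longrightarrow> Lp_bound p ((difference h ^^ k) f) w"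
  shows "Lp_bound p (\<lambda>x. f x - smoothing k t f x) w"
proof -
  note [measurable] = Lp_boundD(1)[OF f] mollify_measurable
  let ?D = "\<lambda>x y. (difference (t *\<^sub>R y) ^^ k) f x"
  have D [measurable]: "(\<lambda>(x, y). ?D x y) \<in> borel_measurable (borel \<Otimes>\<^sub>M borel)"
    unfolding difference_expansion by measurable
  have Dx [measurable]: "?D x \<in> borel_measurable borel" for x
    unfolding difference_expansion by measurable
  have "(\<integral>\<^sup>+x. ennreal (norm (f x - smoothing k t f x) powr p) \<partial>lborel)
      \<le> (\<integral>\<^sup>+x. (\<integral>\<^sup>+y. ennreal (norm (?D x y) powr p * bump y) \<partial>lborel) \<partial>lborel)"
  proof (rule nn_integral_mono)
    fix x
    have "norm (f x - smoothing k t f x) = norm (\<integral>y. bump y *\<^sub>R ?D x y \<partial>lborel)"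
      using p f t by (simp add: diff_smoothing_eq)
    also have "ennreal (\<dots> powr p) \<le> (\<integral>\<^sup>+y. ennreal (norm (?D x y) powr p * bump y) \<partial>lborel)"
      by (rule norm_integral_powr_le[OF p]) (simp_all add: bump_nonneg nn_integral_bump)
    finally show "ennreal (norm (f x - smoothing k t f x) powr p)
        \<le> (\<integral>\<^sup>+y. ennreal (norm (?D x y) powr p * bump y) \<partial>lborel)" .
  qed
  also have "\<dots> = (\<integral>\<^sup>+y. (\<integral>\<^sup>+x. ennreal (norm (?D x y) powr p * bump y) \<partial>lborel) \<partial>lborel)"
    by (rule lborel_pair.Fubini'[symmetric]) measurable
  also have "\<dots> \<le> (\<integral>\<^sup>+y. ennreal (w powr p) * ennreal (bump (y :: real ^ 'n)) \<partial>lborel)"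
  proof (rule nn_integral_mono)
    fix y :: "real ^ 'n"
    have [measurable]: "(\<lambda>x. ?D x y) \<in> borel_measurable borel"
      unfolding difference_expansion by measurable
    show "(\<integral>\<^sup>+x. ennreal (norm (?D x y) powr p * bump y) \<partial>lborel) \<le> ennreal (w powr p) * ennreal (bump y)"
    proof (cases "1 \<le> norm y")
      case True
      then show ?thesis by (simp add: bump_eq_0)
    next
      case False
      then have "Lp_bound p ((difference (t *\<^sub>R y) ^^ k) f) w"
        using t by (intro h) (auto simp: mult_le_cancel_left1)
      then have "(\<integral>\<^sup>+x. ennreal (norm (?D x y) powr p) \<partial>lborel) \<le> ennreal (w powr p)"
        by (rule Lp_boundD)
      then show ?thesis
        by (simp add: ennreal_mult'' bump_nonneg nn_integral_multc mult_right_mono)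
    qed
  qed
  also have "\<dots> = ennreal (w powr p)"
    by (simp add: nn_integral_cmult nn_integral_bump)
  finally show ?thesis
    using w by (simp add: Lp_bound_def smoothing_def)
qed

lemma smoothing_Lp_bound:
  fixes f :: "real ^ 'n \<Rightarrow> 'b::{banach, second_countable_topology}"
  assumes p: "1 < p" and f: "Lp_bound p f m" and t: "0 < t"
  shows "Lp_bound p (smoothing k t f) (4 * (m + 8 ^ k * m))"
proof -
  have "Lp_bound p (\<lambda>x. f x - smoothing k t f x) (8 ^ k * m)"
    using Lp_boundD(2)[OF f] by (intro Lp_bound_diff_smoothing[OF p f t] Lp_bound_difference[OF p f]) auto
  from Lp_bound_diff[OF p f this] show ?thesis by simp
qed

section \<open>Lipschitz estimates for the smoothed function\<close>

lemma sum_choose_le: "(\<Sum>i=1..k. real (k choose i)) \<le> 2 ^ k"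
proof -
  have "(\<Sum>i=1..k. real (k choose i)) \<le> (\<Sum>i\<le>k. real (k choose i))"
    by (intro sum_mono2) auto
  also have "\<dots> = 2 ^ k"
    by (simp add: choose_row_sum flip: of_nat_sum)
  finally show ?thesis .
qed

lemma norm_smoothing_diff_le:
  fixes f :: "'a::euclidean_space \<Rightarrow> 'b::{banach, second_countable_topology}"
  assumes "\<And>i. 1 \<le> i \<Longrightarrow> i \<le> k \<Longrightarrow> norm (mollify (real i * t) f x - mollify (real i * t) f x') \<le> L"
    and "0 \<le> L"
  shows "norm (smoothing k t f x - smoothing k t f x') \<le> 2 ^ k * L"
proof -
  have "smoothing k t f x - smoothing k t f x' =
      (\<Sum>i=1..k. ((-1) ^ Suc i * real (k choose i)) *\<^sub>R (mollify (real i * t) f x - mollify (real i * t) f x'))"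
    by (simp only: smoothing_def sum_subtractf scaleR_diff_right)
  also have "norm \<dots> \<le> (\<Sum>i=1..k. real (k choose i) * L)"
    using assms by (intro sum_norm_le) (auto simp: power_abs abs_mult intro!: mult_left_mono)
  also have "\<dots> \<le> 2 ^ k * L"
    unfolding sum_distrib_right[symmetric] by (intro mult_right_mono sum_choose_le assms)
  finally show ?thesis .
qed

text \<open>The scales \<open>real i * T\<close> are all at least \<open>T\<close> and the exponent
  \<open>- 1 - DIM('a) / p\<close> is negative, so the bound at scale \<open>T\<close> dominates.
  The constant is obtained before \<open>f\<close>, \<open>m\<close> and \<open>T\<close>.\<close>

lemma smoothing_lipschitz:
  assumes p: "1 < p"
  obtains C where "0 < C"
    "\<And>(f :: 'a::euclidean_space \<Rightarrow> 'b::{banach, second_countable_topology}) m T x x'.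
      Lp_bound p f m \<Longrightarrow> 0 < T \<Longrightarrow>
      norm (smoothing k T f x - smoothing k T f x') \<le> C * T powr (- 1 - DIM('a) / p) * m * norm (x - x')"
proof -
  define c where "c = (2 * unit_ball_vol (real DIM('a))) powr (1 - 1 / p) / tent_mass TYPE('a)"
  have c: "0 < c"
    using tent_mass(1)[where 'a='a] by (simp add: c_def less_imp_neq[OF unit_ball_vol_pos, symmetric])
  have e: "0 \<le> DIM('a) / p" using p by simp
  show ?thesis
  proof (rule that[of "2 ^ k * c"])
    fix f :: "'a \<Rightarrow> 'b" and m T :: real and x x' :: 'a
    assume f: "Lp_bound p f m" and T: "0 < T"
    note m = Lp_boundD(2)[OF f]
    have "norm (smoothing k T f x - smoothing k T f x')
        \<le> 2 ^ k * (c * T powr (- 1 - DIM('a) / p) * m * norm (x - x'))"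
    proof (rule norm_smoothing_diff_le)
      fix i assume i: "1 \<le> i" "i \<le> k"
      have "norm (mollify (real i * T) f x - mollify (real i * T) f x')
          \<le> c * (real i * T) powr (- 1 - DIM('a) / p) * m * norm (x - x')"
        unfolding c_def using i T by (intro mollify_lipschitz[OF p f]) auto
      also have "\<dots> \<le> c * T powr (- 1 - DIM('a) / p) * m * norm (x - x')"
      proof -
        have "T \<le> real i * T" using i T by simp
        then have "(real i * T) powr (- 1 - DIM('a) / p) \<le> T powr (- 1 - DIM('a) / p)"
          using T e by (intro powr_mono2') linarith+
        then show ?thesis using c m by (intro mult_right_mono mult_left_mono) auto
      qed
      finally show "norm (mollify (real i * T) f x - mollify (real i * T) f x')
          \<le> c * T powr (- 1 - DIM('a) / p) * m * norm (x - x')" .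
    qed (use c m in auto)
    then show "norm (smoothing k T f x - smoothing k T f x')
        \<le> 2 ^ k * c * T powr (- 1 - DIM('a) / p) * m * norm (x - x')"
      by (simp add: mult.assoc)
  qed (use c in auto)
qed

text \<open>
  One step splits \<open>f\<close> into \<open>f - G\<close> and \<open>G = smoothing k (A * T) f\<close>. Smoothing \<open>G\<close> once more costs
  a factor \<open>2 ^ k\<close> in the Lipschitz constant, while passing from \<open>T\<close> to \<open>A * T\<close> gains a factor
  \<open>A\<close>; hence the choice \<open>A = 2 ^ Suc k\<close>.
\<close>

lemma smoothing_lipschitz_iterate:
  fixes f :: "real ^ 'n \<Rightarrow> 'b::{banach, second_countable_topology}"
  assumes p: "1 < p" and f: "Lp_bound p f m" and t: "0 < t" and W: "0 \<le> W"
    and \<omega>: "\<And>u h. t < u \<Longrightarrow> norm h \<le> u \<Longrightarrow> Lp_bound p ((difference h ^^ k) f) (u powr e * W)"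
    and C: "0 < C" "\<And>(g :: real ^ 'n \<Rightarrow> 'b) m T x x'. Lp_bound p g m \<Longrightarrow> 0 < T \<Longrightarrow>
      norm (smoothing k T g x - smoothing k T g x') \<le> C * T powr (- 1 - e) * m * norm (x - x')"
    and T: "t \<le> T"
  shows "norm (smoothing k T f x - smoothing k T f x') \<le>
    (2 * C * (2 ^ Suc k) powr e * W / T + (2 ^ k) ^ J * C * ((2 ^ Suc k) ^ J * T) powr (- 1 - e) * m) * norm (x - x')"
  using T
proof (induction J arbitrary: T x x')
  case 0
  have "norm (smoothing k T f x - smoothing k T f x') \<le> C * T powr (- 1 - e) * m * norm (x - x')"
    using 0 t by (intro C(2) f) auto
  also have "\<dots> \<le> (2 * C * (2 ^ Suc k) powr e * W / T + C * T powr (- 1 - e) * m) * norm (x - x')"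
    using 0 t C(1) W by (intro mult_right_mono) auto
  finally show ?case by simp
next
  case (Suc J)
  define A :: real where "A = 2 ^ Suc k"
  have A2: "2 \<le> A" unfolding A_def by simp
  have Tpos: "0 < T" using Suc.prems t by simp
  \<comment> \<open>The smoothness hypothesis covers only \<open>u > t\<close>; the larger scale
    satisfies this strictly even when \<open>T = t\<close>.\<close>
  have "T < A * T" using mult_strict_right_mono[of 1 A T] A2 Tpos by linarith
  then have AT: "t < A * T" "0 < A * T" using Suc.prems Tpos by linarith+
  define G where "G = smoothing k (A * T) f"
  have G: "Lp_bound p G (4 * (m + 8 ^ k * m))"
    unfolding G_def using p f AT(2) by (rule smoothing_Lp_bound)
  have g: "Lp_bound p (\<lambda>x. f x - G x) ((A * T) powr e * W)"
    unfolding G_def using AT W by (intro Lp_bound_diff_smoothing[OF p f] \<omega>) auto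
  have split: "smoothing k T f x = smoothing k T (\<lambda>x. f x - G x) x + smoothing k T G x" for x
    using smoothing_add[OF p g G Tpos, of k x] by simp
  define R where "R = 2 * C * A powr e * W / (A * T) + (2 ^ k) ^ J * C * (A ^ J * (A * T)) powr (- 1 - e) * m"
  have R: "norm (G x - G x') \<le> R * norm (x - x')" for x x'
    unfolding G_def R_def using Suc.IH[of "A * T" x x'] AT by (simp add: A_def)
  have "0 \<le> R"
    unfolding R_def using C(1) W AT Lp_boundD(2)[OF f] by auto
  have "norm (smoothing k T f x - smoothing k T f x')
      \<le> norm (smoothing k T (\<lambda>x. f x - G x) x - smoothing k T (\<lambda>x. f x - G x) x')
        + norm (smoothing k T G x - smoothing k T G x')"
    unfolding split by (rule order_trans[OF eq_refl norm_triangle_ineq]) (simp add: algebra_simps)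
  also have "\<dots> \<le> C * T powr (- 1 - e) * ((A * T) powr e * W) * norm (x - x') + 2 ^ k * (R * norm (x - x'))"
  proof (rule add_mono)
    show "norm (smoothing k T (\<lambda>x. f x - G x) x - smoothing k T (\<lambda>x. f x - G x) x')
        \<le> C * T powr (- 1 - e) * ((A * T) powr e * W) * norm (x - x')"
      using g Tpos by (rule C(2))
    show "norm (smoothing k T G x - smoothing k T G x') \<le> 2 ^ k * (R * norm (x - x'))"
      using Tpos \<open>0 \<le> R\<close> by (intro norm_smoothing_diff_le mollify_lipschitz_transfer[OF p G _ R]) auto
  qed
  also have "C * T powr (- 1 - e) * ((A * T) powr e * W) = C * A powr e * W / T"
  proof -
    have "T powr (- 1 - e) * T powr e = 1 / T"
      using Tpos by (simp add: powr_add[symmetric] powr_minus_divide)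
    moreover have "C * T powr (- 1 - e) * ((A * T) powr e * W) = C * A powr e * W * (T powr (- 1 - e) * T powr e)"
      using A2 Tpos by (simp add: powr_mult mult_ac)
    ultimately show ?thesis by simp
  qed
  also have "C * A powr e * W / T * norm (x - x') + 2 ^ k * (R * norm (x - x'))
      = (C * A powr e * W / T + 2 ^ k * R) * norm (x - x')"
    by (simp add: algebra_simps)
  also have "C * A powr e * W / T + 2 ^ k * R
      = 2 * C * A powr e * W / T + (2 ^ k) ^ Suc J * C * (A ^ Suc J * T) powr (- 1 - e) * m"
  proof -
    \<comment> \<open>As \<open>A\<close> is twice \<open>2 ^ k\<close>, the term inherited from the
      larger scale becomes a second copy of the new one. The two copies add up to the factor 2 of
      the claim, which closes the induction.\<close>
    have "2 ^ k * (2 * C * A powr e * W / (A * T)) = C * A powr e * W / T"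
      using Tpos by (simp add: A_def)
    moreover have "2 ^ k * R = 2 ^ k * (2 * C * A powr e * W / (A * T))
        + (2 ^ k) ^ Suc J * C * (A ^ Suc J * T) powr (- 1 - e) * m"
      unfolding R_def distrib_left by (simp add: mult_ac)
    ultimately show ?thesis by simp
  qed
  finally show ?case by (simp add: A_def)
qed

text \<open>Let \<open>J\<close> tend to infinity in the preceding bound. Since
  \<open>0 \<le> e\<close>, the remainder decays at least like
  \<open>(2 ^ k / A) ^ J = (1 / 2) ^ J\<close>, so \<open>m\<close> disappears from the estimate and
  only the smoothness bound \<open>W\<close> is left.\<close>

lemma smoothing_lipschitz_smoothness:
  fixes f :: "real ^ 'n \<Rightarrow> 'b::{banach, second_countable_topology}"
  assumes p: "1 < p" and f: "Lp_bound p f m" and t: "0 < t" and W: "0 \<le> W" and e: "0 \<le> e"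
    and \<omega>: "\<And>u h. t < u \<Longrightarrow> norm h \<le> u \<Longrightarrow> Lp_bound p ((difference h ^^ k) f) (u powr e * W)"
    and C: "0 < C" "\<And>(g :: real ^ 'n \<Rightarrow> 'b) m T x x'. Lp_bound p g m \<Longrightarrow> 0 < T \<Longrightarrow>
      norm (smoothing k T g x - smoothing k T g x') \<le> C * T powr (- 1 - e) * m * norm (x - x')"
    and T: "t \<le> T"
  shows "norm (smoothing k T f x - smoothing k T f x') \<le> 2 * C * (2 ^ Suc k) powr e * W / T * norm (x - x')"
proof -
  define A :: real where "A = 2 ^ Suc k"
  define Y where "Y = C * T powr (- 1 - e) * m"
  have Tpos: "0 < T" using t T by simp
  have m: "0 \<le> m" using f by (rule Lp_boundD)
  have "norm (smoothing k T f x - smoothing k T f x')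
      \<le> (2 * C * A powr e * W / T + (1 / 2) ^ J * Y) * norm (x - x')" for J
  proof -
    have "(2 ^ k) ^ J * (A ^ J) powr (- 1 - e) \<le> (2 ^ k) ^ J * (A ^ J) powr (- 1)"
      using e by (intro mult_left_mono powr_mono) (auto simp: A_def one_le_power simp del: power_Suc)
    also have "\<dots> = (2 ^ k / A) ^ J"
      by (simp add: powr_minus_divide power_divide A_def del: power_Suc)
    also have "2 ^ k / A = 1 / 2" by (simp add: A_def)
    finally have "(2 ^ k) ^ J * (A ^ J) powr (- 1 - e) * Y \<le> (1 / 2) ^ J * Y"
      using C(1) m by (intro mult_right_mono) (auto simp: Y_def)
    moreover have "(2 ^ k) ^ J * C * (A ^ J * T) powr (- 1 - e) * m = (2 ^ k) ^ J * (A ^ J) powr (- 1 - e) * Y"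
      using Tpos by (simp add: Y_def powr_mult A_def)
    ultimately have "(2 ^ k) ^ J * C * (A ^ J * T) powr (- 1 - e) * m \<le> (1 / 2) ^ J * Y"
      by (simp only:)
    then have "(2 * C * A powr e * W / T + (2 ^ k) ^ J * C * (A ^ J * T) powr (- 1 - e) * m) * norm (x - x')
        \<le> (2 * C * A powr e * W / T + (1 / 2) ^ J * Y) * norm (x - x')"
      by (intro mult_right_mono) auto
    with smoothing_lipschitz_iterate[OF p f t W \<omega> C T, of x x' J] show ?thesis
      unfolding A_def by (rule order_trans)
  qed
  moreover have "(\<lambda>J. (2 * C * A powr e * W / T + (1 / 2) ^ J * Y) * norm (x - x'))
      \<longlonglongrightarrow> (2 * C * A powr e * W / T + 0 * Y) * norm (x - x')"
    by (intro tendsto_intros LIMSEQ_power_zero) auto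
  ultimately show ?thesis
    by (intro LIMSEQ_le_const) (auto simp: A_def)
qed

subsection \<open>Mean oscillation on cubes\<close>

text \<open>The distance from \<open>c\<close> to the average is at most the mean of
  \<open>norm (f y - c)\<close>, so replacing the average by an arbitrary constant costs a factor
  2.\<close>

lemma set_nn_integral_diff_average_le:
  fixes f :: "real ^ 'n \<Rightarrow> 'b::{banach, second_countable_topology}" and a :: "real ^ 'n"
  assumes p: "1 < p" and f: "Lp_bound p f m" and s: "0 < s"
  defines "Q \<equiv> cbox a (a + (\<chi> i. s))"
  shows "(\<integral>\<^sup>+y\<in>Q. ennreal (norm (f y - average Q f)) \<partial>lborel)
    \<le> 2 * (\<integral>\<^sup>+y\<in>Q. ennreal (norm (f y - c)) \<partial>lborel)"
proof -
  note [measurable] = Lp_boundD(1)[OF f]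
  have [measurable]: "Q \<in> sets borel" by (simp add: Q_def)
  define N where "N = s ^ CARD('n)"
  have N: "0 < N" using s by (simp add: N_def)
  have em: "emeasure lborel Q = ennreal N"
    using s by (simp add: Q_def N_def emeasure_cube)
  \<comment> \<open>Hoelder on the cube makes \<open>f\<close> integrable there, so that
    \<open>average Q f\<close> is a genuine mean and not a default value.\<close>
  have "(\<integral>\<^sup>+x\<in>Q. ennreal (norm (f x)) \<partial>lborel) \<le> ennreal (N powr (1 - 1 / p) * m)"
    by (rule nn_integral_set_norm_le[OF p f]) (use N in \<open>auto simp: em\<close>)
  also have "\<dots> < \<infinity>" by simp
  finally have intf: "set_integrable lborel Q f"
    unfolding set_integrable_def
    by (intro integrableI_bounded) (auto simp: mult.commute ennreal_mult'' ennreal_indicator)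
  have intc: "set_integrable lborel Q (\<lambda>_. c)"
    unfolding set_integrable_def using em by (auto intro!: integrable_scaleR_left)
  have av: "average Q f = (1 / N) *\<^sub>R (LINT x:Q|lborel. f x)"
    using N by (simp add: average_def set_lebesgue_integral_def integral_completion measure_def em)
  have const: "(LINT x:Q|lborel. c) = N *\<^sub>R c"
    unfolding set_lebesgue_integral_def using em N
    by (subst integral_scaleR_left) (auto simp: measure_def)
  have "(LINT x:Q|lborel. f x - c) = (LINT x:Q|lborel. f x) - N *\<^sub>R c"
    using intf intc by (simp add: set_integral_diff const)
  then have "average Q f - c = (1 / N) *\<^sub>R (LINT x:Q|lborel. (f x - c))"
    using N by (simp add: av scaleR_diff_right)
  then have "ennreal (N * norm (c - average Q f)) = ennreal (norm (LINT x:Q|lborel. (f x - c)))"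
    using N by (simp add: norm_minus_commute[of c])
  also have "\<dots> \<le> (\<integral>\<^sup>+y. ennreal (norm (indicator Q y *\<^sub>R (f y - c))) \<partial>lborel)"
    unfolding set_lebesgue_integral_def
    using set_integral_diff(1)[OF intf intc]
    by (intro integral_norm_bound_ennreal) (simp add: set_integrable_def)
  also have "\<dots> = (\<integral>\<^sup>+y\<in>Q. ennreal (norm (f y - c)) \<partial>lborel)"
    by (intro nn_integral_cong) (auto split: split_indicator)
  finally have *: "ennreal (N * norm (c - average Q f)) \<le> (\<integral>\<^sup>+y\<in>Q. ennreal (norm (f y - c)) \<partial>lborel)" .
  have "(\<integral>\<^sup>+y\<in>Q. ennreal (norm (f y - average Q f)) \<partial>lborel)
    \<le> (\<integral>\<^sup>+y. ennreal (norm (f y - c)) * indicator Q y + ennreal (norm (c - average Q f)) * indicator Q y \<partial>lborel)"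
  proof (rule nn_integral_mono)
    fix y
    have "ennreal (norm (f y - average Q f)) \<le> ennreal (norm (f y - c) + norm (c - average Q f))"
      using norm_triangle_ineq[of "f y - c" "c - average Q f"] by (intro ennreal_leI) simp
    then show "ennreal (norm (f y - average Q f)) * indicator Q y
        \<le> ennreal (norm (f y - c)) * indicator Q y + ennreal (norm (c - average Q f)) * indicator Q y"
      by (simp split: split_indicator)
  qed
  also have "\<dots> = (\<integral>\<^sup>+y\<in>Q. ennreal (norm (f y - c)) \<partial>lborel) + ennreal (N * norm (c - average Q f))"
  proof -
    have "(\<integral>\<^sup>+y\<in>Q. ennreal (norm (c - average Q f)) \<partial>lborel) = ennreal (N * norm (c - average Q f))"
      using N by (subst nn_integral_cmult_indicator) (auto simp: em ennreal_mult mult.commute)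
    then show ?thesis by (subst nn_integral_add) simp_all
  qed
  also have "\<dots> \<le> (\<integral>\<^sup>+y\<in>Q. ennreal (norm (f y - c)) \<partial>lborel) + (\<integral>\<^sup>+y\<in>Q. ennreal (norm (f y - c)) \<partial>lborel)"
    by (intro add_left_mono *)
  finally show ?thesis by (simp add: mult_2)
qed

text \<open>The comparison constant is \<open>G a\<close>, the value at a corner of the cube;
  \<open>G\<close> varies from it by at most \<open>L * (CARD('n) * s)\<close> on the cube.\<close>

lemma oscillation_le_lipschitz_part:
  fixes f G :: "real ^ 'n \<Rightarrow> 'b::{banach, second_countable_topology}" and a :: "real ^ 'n"
  assumes p: "1 < p" and f: "Lp_bound p f m" and s: "0 < s"
    and [measurable]: "G \<in> borel_measurable borel"
    and L: "0 \<le> L" "\<And>x y. norm (G x - G y) \<le> L * norm (x - y)"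
  defines "Q \<equiv> cbox a (a + (\<chi> i. s))"
  shows "(\<integral>\<^sup>+y\<in>Q. ennreal (norm (f y - average Q f)) \<partial>lborel)
    \<le> 2 * (\<integral>\<^sup>+y\<in>Q. ennreal (norm (f y - G y)) \<partial>lborel) + ennreal (2 * L * CARD('n) * s * s ^ CARD('n))"
proof -
  note [measurable] = Lp_boundD(1)[OF f]
  have [measurable]: "Q \<in> sets borel" by (simp add: Q_def)
  have aQ: "a \<in> Q" using s by (auto simp: Q_def mem_box_cart)
  have em: "emeasure lborel Q = ennreal (s ^ CARD('n))"
    using s by (simp add: Q_def emeasure_cube)
  have "(\<integral>\<^sup>+y\<in>Q. ennreal (norm (f y - G a)) \<partial>lborel)
    \<le> (\<integral>\<^sup>+y. ennreal (norm (f y - G y)) * indicator Q y + ennreal (L * (CARD('n) * s)) * indicator Q y \<partial>lborel)"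
  proof (rule nn_integral_mono)
    fix y
    have "ennreal (norm (f y - G a)) \<le> ennreal (norm (f y - G y)) + ennreal (L * (CARD('n) * s))" if "y \<in> Q"
    proof -
      have "norm (f y - G a) \<le> norm (f y - G y) + norm (G y - G a)"
        using norm_triangle_ineq[of "f y - G y" "G y - G a"] by simp
      also have "norm (G y - G a) \<le> L * norm (y - a)" by (rule L)
      also have "\<dots> \<le> L * (CARD('n) * s)"
        using that aQ L(1) by (intro mult_left_mono cube_norm_diff_le[of _ a]) (auto simp: Q_def)
      finally show ?thesis
        using L(1) s by (simp add: ennreal_plus[symmetric] del: ennreal_plus)
    qed
    then show "ennreal (norm (f y - G a)) * indicator Q y
      \<le> ennreal (norm (f y - G y)) * indicator Q y + ennreal (L * (CARD('n) * s)) * indicator Q y"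
      by (simp split: split_indicator)
  qed
  also have "\<dots> = (\<integral>\<^sup>+y\<in>Q. ennreal (norm (f y - G y)) \<partial>lborel) + ennreal (L * (CARD('n) * s)) * ennreal (s ^ CARD('n))"
    by (subst nn_integral_add) (auto simp: nn_integral_cmult_indicator em)
  finally have "2 * (\<integral>\<^sup>+y\<in>Q. ennreal (norm (f y - G a)) \<partial>lborel)
      \<le> 2 * ((\<integral>\<^sup>+y\<in>Q. ennreal (norm (f y - G y)) \<partial>lborel) + ennreal (L * (CARD('n) * s)) * ennreal (s ^ CARD('n)))"
    by (rule mult_left_mono) simp
  also have "\<dots> = 2 * (\<integral>\<^sup>+y\<in>Q. ennreal (norm (f y - G y)) \<partial>lborel) + ennreal (2 * L * CARD('n) * s * s ^ CARD('n))"
  proof -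
    have "ennreal (2 * L * CARD('n) * s * s ^ CARD('n)) = ennreal (2 * ((L * (CARD('n) * s)) * s ^ CARD('n)))"
      by (simp add: mult_ac)
    also have "\<dots> = 2 * (ennreal (L * (CARD('n) * s)) * ennreal (s ^ CARD('n)))"
      using L(1) s by (subst ennreal_mult, simp, simp, subst ennreal_mult) auto
    finally show ?thesis by (simp add: distrib_left)
  qed
  finally show ?thesis
    using set_nn_integral_diff_average_le[OF p f s, of a "G a", folded Q_def] by (rule order_trans[rotated])
qed

text \<open>The real number \<open>W\<close> stands for any bound of \<open>u powr (- e)\<close>
  times the modulus of smoothness at \<open>u > t\<close>. Both inequalities of the theorem follow
  by inserting a suitable \<open>W\<close>, with one constant fixed before the function and the
  scale.\<close>

lemma sharp_maximal_rearrangement_bound: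
  fixes k :: nat and p :: real
  assumes p: "1 < p"
  defines "e \<equiv> real CARD('n::finite) / p"
  obtains C where "0 < C"
    "\<And>(f :: real ^ 'n \<Rightarrow> 'b::{banach, second_countable_topology}) m t W.
      Lp_bound p f m \<Longrightarrow> 0 < t \<Longrightarrow> 0 \<le> W \<Longrightarrow>
      (\<And>u h. t < u \<Longrightarrow> norm h \<le> u \<Longrightarrow> Lp_bound p ((difference h ^^ k) f) (u powr e * W)) \<Longrightarrow>
      epowr (\<integral>\<^sup>+u\<in>{0<..<t ^ CARD('n)}. epowr (rearrangement (sharp_maximal f) u) p \<partial>lborel) (1 / p)
        \<le> ennreal (C * (t powr e * W))"
proof -
  let ?d = "CARD('n)"
  obtain C where C: "0 < C"
    "\<And>(g :: real ^ 'n \<Rightarrow> 'b) m T x x'. Lp_bound p g m \<Longrightarrow> 0 < T \<Longrightarrow>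
      norm (smoothing k T g x - smoothing k T g x') \<le> C * T powr (- 1 - e) * m * norm (x - x')"
    using smoothing_lipschitz[OF p, where 'a="real ^ 'n" and 'b='b and k=k] unfolding e_def by auto
  have e: "0 \<le> e" using p by (simp add: e_def)
  define L where "L = 2 * C * (2 ^ Suc k) powr e"
  have L: "0 < L" using C by (simp add: L_def)
  \<comment> \<open>The first summand is the oscillation of the Lipschitz part over a cube, the
    second the Hoelder term that arises for cubes of side larger than \<open>t\<close>.\<close>
  define b where "b = 2 * L * ?d + 2"
  have b: "0 < b" using L by (simp add: b_def add_nonneg_pos)
  define K where "K = (5 ^ ?d * 4 * (unit_ball_vol (real ?d) * real ?d ^ ?d)) * 4 powr (p - 1) * p / (p - 1)"
  have K: "0 \<le> K" using p by (simp add: K_def)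
  define c where "c = 2 powr p * (b powr p + K * 2 powr ?d)"
  have c: "0 < c" using b K by (simp add: c_def add_pos_nonneg)
  show ?thesis
  proof (rule that[of "c powr (1 / p)"])
    show "0 < c powr (1 / p)" using c by simp
    fix f :: "real ^ 'n \<Rightarrow> 'b" and m t W :: real
    assume f: "Lp_bound p f m" and t: "0 < t" and W: "0 \<le> W"
      and \<omega>: "\<And>u h. t < u \<Longrightarrow> norm h \<le> u \<Longrightarrow> Lp_bound p ((difference h ^^ k) f) (u powr e * W)"
    note [measurable] = Lp_boundD(1)[OF f]
    define g where "g = (\<lambda>x. f x - smoothing k t f x)"
    have lip: "norm (smoothing k T f x - smoothing k T f y) \<le> L * W / T * norm (x - y)" if "t \<le> T" for T x y
      unfolding L_def by (rule smoothing_lipschitz_smoothness[OF p f t W e \<omega> C that])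
    \<comment> \<open>The hypothesis starts strictly above \<open>t\<close>, so the error at scale
      \<open>t\<close> is measured at \<open>2 * t\<close>. After taking \<open>p\<close>-th powers
      this is the factor \<open>2 powr ?d\<close> in \<open>c\<close>.\<close>
    have g: "Lp_bound p g ((2 * t) powr e * W)"
      unfolding g_def using t W by (intro Lp_bound_diff_smoothing[OF p f t] \<omega>[of "2 * t"]) auto
    note [measurable] = Lp_boundD(1)[OF g]
    have osc: "(\<integral>\<^sup>+y\<in>Q. ennreal (norm (f y - average Q f)) \<partial>lborel)
        \<le> 2 * (\<integral>\<^sup>+y\<in>Q. ennreal (norm (g y)) \<partial>lborel) + ennreal (b * W * s ^ ?d)"
      if s: "0 < s" and Q: "Q = cbox a (a + (\<chi> i. s))" for s a Q
    proof (cases "s \<le> t")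
      case True
      have "(\<integral>\<^sup>+y\<in>Q. ennreal (norm (f y - average Q f)) \<partial>lborel)
          \<le> 2 * (\<integral>\<^sup>+y\<in>Q. ennreal (norm (g y)) \<partial>lborel) + ennreal (2 * (L * W / t) * ?d * s * s ^ ?d)"
        unfolding Q g_def using L W t lip
        by (intro oscillation_le_lipschitz_part[OF p f s] Lp_boundD(1)[OF smoothing_Lp_bound[OF p f t]]) auto
      also have "2 * (L * W / t) * ?d * s * s ^ ?d \<le> b * W * s ^ ?d"
      proof (rule mult_right_mono)
        have "2 * (L * W / t) * ?d * s = 2 * L * ?d * W * (s / t)" by simp
        also have "\<dots> \<le> 2 * L * ?d * W * 1"
          using True t L W by (intro mult_left_mono) auto
        also have "\<dots> \<le> b * W" using W by (simp add: b_def distrib_right)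
        finally show "2 * (L * W / t) * ?d * s \<le> b * W" .
      qed (use s in simp)
      finally show ?thesis by (simp add: add_left_mono ennreal_leI)
    next
      case False
      then have st: "t \<le> s" "t < s" by auto
      \<comment> \<open>On a large cube \<open>f\<close> is smoothed at the scale \<open>s\<close>
        of the cube itself. Hoelder then bounds the whole error by \<open>s ^ ?d * W\<close>, since
        the powers of \<open>s\<close> with exponents \<open>- e\<close> and \<open>e\<close>
        cancel, and nothing is left for the maximal function.\<close>
      have gs: "Lp_bound p (\<lambda>x. f x - smoothing k s f x) (s powr e * W)"
        using s W st by (intro Lp_bound_diff_smoothing[OF p f s] \<omega>) auto
      have "(\<integral>\<^sup>+y\<in>Q. ennreal (norm (f y - average Q f)) \<partial>lborel)
          \<le> 2 * (\<integral>\<^sup>+y\<in>Q. ennreal (norm (f y - smoothing k s f y)) \<partial>lborel) + ennreal (2 * (L * W / s) * ?d * s * s ^ ?d)"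
        unfolding Q using L W s lip[OF st(1)]
        by (intro oscillation_le_lipschitz_part[OF p f s] Lp_boundD(1)[OF smoothing_Lp_bound[OF p f s]]) auto
      also have "\<dots> \<le> 2 * ennreal (s ^ ?d * W) + ennreal (2 * L * ?d * W * s ^ ?d)"
      proof (intro add_mono mult_left_mono)
        have "(\<integral>\<^sup>+y\<in>Q. ennreal (norm (f y - smoothing k s f y)) \<partial>lborel)
            \<le> ennreal ((s ^ ?d) powr (1 - 1 / p) * (s powr e * W))"
          using s by (intro nn_integral_set_norm_le[OF p gs]) (auto simp: Q emeasure_cube)
        also have "(s ^ ?d) powr (1 - 1 / p) * (s powr e * W) = s ^ ?d * W"
        proof -
          have "(s ^ ?d) powr (1 - 1 / p) = s powr (?d - e)"
            using s by (simp add: powr_realpow[symmetric] powr_powr right_diff_distrib e_def)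
          then show ?thesis
            using s by (simp add: powr_diff powr_realpow)
        qed
        finally show "(\<integral>\<^sup>+y\<in>Q. ennreal (norm (f y - smoothing k s f y)) \<partial>lborel) \<le> ennreal (s ^ ?d * W)" .
        show "ennreal (2 * (L * W / s) * ?d * s * s ^ ?d) \<le> ennreal (2 * L * ?d * W * s ^ ?d)"
          using s by (simp add: mult_ac)
      qed auto
      also have "\<dots> = ennreal (b * W * s ^ ?d)"
      proof -
        have "2 * ennreal (s ^ ?d * W) = ennreal (2 * (s ^ ?d * W))"
          using s W by (simp add: ennreal_mult)
        then show ?thesis
          using s W L by (simp add: ennreal_plus[symmetric] b_def algebra_simps del: ennreal_plus)
      qed
      finally show ?thesis by (rule order_trans) simp
    qed
    have "(\<integral>\<^sup>+u\<in>{0<..<t ^ ?d}. epowr (rearrangement (sharp_maximal f) u) p \<partial>lborel)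
      \<le> ennreal (2 powr p) * (ennreal (t ^ ?d * (b * W) powr p) +
          ennreal K * (\<integral>\<^sup>+x. ennreal (norm (g x) powr p) \<partial>lborel))"
      unfolding K_def
    proof (rule rearrangement_maximal_bound[OF p])
      fix x l assume less: "ennreal (b * W + l) < sharp_maximal f x" and l: "0 < l"
      from less obtain Q where Q: "Q \<in> cubes" "x \<in> Q" and big:
        "ennreal (b * W + l) < (\<integral>\<^sup>+y\<in>Q. ennreal (norm (f y - average Q f)) \<partial>lebesgue) / emeasure lebesgue Q"
        unfolding sharp_maximal_def less_SUP_iff by auto
      from Q(1) obtain a s where s: "0 < s" and Qs: "Q = cbox a (a + (\<chi> i. s))"
        by (auto simp: cubes_def)
      have em: "emeasure lebesgue Q = ennreal (s ^ ?d)"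
        using s by (simp add: Qs emeasure_cube)
      let ?X = "\<integral>\<^sup>+y\<in>Q. ennreal (norm (f y - average Q f)) \<partial>lborel"
      let ?Y = "\<integral>\<^sup>+y\<in>Q. ennreal (norm (g y)) \<partial>lborel"
      have "\<not> ?X \<le> ennreal ((b * W + l) * s ^ ?d)"
      proof
        assume "?X \<le> ennreal ((b * W + l) * s ^ ?d)"
        then have "?X / ennreal (s ^ ?d) \<le> ennreal ((b * W + l) * s ^ ?d) / ennreal (s ^ ?d)"
          by (rule divide_right_mono_ennreal)
        also have "\<dots> = ennreal (b * W + l)"
          using s b W l by (subst divide_ennreal) auto
        finally show False
          using big by (simp add: em nn_integral_completion)
      qed
      then have "ennreal ((b * W + l) * s ^ ?d) < 2 * ?Y + ennreal (b * W * s ^ ?d)"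
        using osc[OF s Qs] by (meson less_le_trans not_le)
      \<comment> \<open>By \<open>osc\<close> the integral of \<open>norm (g y)\<close> enters
        doubled, so an excess \<open>l\<close> over \<open>b * W\<close> forces its mean above
        \<open>l / 2\<close>.\<close>
      have "\<not> ?Y \<le> ennreal (l / 2 * s ^ ?d)"
      proof
        assume "?Y \<le> ennreal (l / 2 * s ^ ?d)"
        then have "2 * ?Y + ennreal (b * W * s ^ ?d) \<le> 2 * ennreal (l / 2 * s ^ ?d) + ennreal (b * W * s ^ ?d)"
          by (intro add_mono mult_left_mono) auto
        also have "2 * ennreal (l / 2 * s ^ ?d) = ennreal (2 * (l / 2 * s ^ ?d))"
          using l s by (subst ennreal_mult) auto
        also have "\<dots> + ennreal (b * W * s ^ ?d) = ennreal (2 * (l / 2 * s ^ ?d) + b * W * s ^ ?d)"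
          using l s b W by (intro ennreal_plus[symmetric]) auto
        also have "2 * (l / 2 * s ^ ?d) + b * W * s ^ ?d = (b * W + l) * s ^ ?d"
          by (simp add: algebra_simps)
        finally show False
          using \<open>ennreal ((b * W + l) * s ^ ?d) < 2 * ?Y + ennreal (b * W * s ^ ?d)\<close> by simp
      qed
      then show "\<exists>a s. 0 < s \<and> x \<in> cbox a (a + (\<chi> i. s)) \<and>
          ennreal (l / 2 * s ^ ?d) < (\<integral>\<^sup>+y\<in>cbox a (a + (\<chi> i. s)). ennreal (norm (g y)) \<partial>lborel)"
        using s Q(2) unfolding Qs not_le by blast
    qed (use b W t in auto)
    also have "\<dots> \<le> ennreal (2 powr p) * (ennreal (t ^ ?d * (b * W) powr p) + ennreal K * ennreal (((2 * t) powr e * W) powr p))"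
      by (intro mult_left_mono add_left_mono Lp_boundD(3)[OF g]) auto
    also have "\<dots> = ennreal (2 powr p * (t ^ ?d * (b * W) powr p + K * ((2 * t) powr e * W) powr p))"
      using t K by (simp add: ennreal_mult ennreal_plus)
    also have "2 powr p * (t ^ ?d * (b * W) powr p + K * ((2 * t) powr e * W) powr p)
        = (c powr (1 / p) * (t powr e * W)) powr p"
    proof -
      \<comment> \<open>This identity makes both terms scale alike: each becomes a constant times
        \<open>t ^ ?d * W powr p\<close>.\<close>
      have "e * p = ?d" using p by (simp add: e_def)
      then have "(t powr e * W) powr p = t ^ ?d * W powr p" "((2 * t) powr e * W) powr p = 2 powr ?d * t ^ ?d * W powr p"
        using t W by (simp_all add: powr_mult powr_powr powr_realpow)
      moreover have "(c powr (1 / p) * (t powr e * W)) powr p = c * (t powr e * W) powr p"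
        using c t W p by (subst powr_mult) (auto simp: powr_powr)
      moreover have "(b * W) powr p = b powr p * W powr p"
        using b W by (simp add: powr_mult)
      ultimately show ?thesis
        by (simp add: c_def algebra_simps)
    qed
    finally show "epowr (\<integral>\<^sup>+u\<in>{0<..<t ^ ?d}. epowr (rearrangement (sharp_maximal f) u) p \<partial>lborel) (1 / p)
        \<le> ennreal (c powr (1 / p) * (t powr e * W))"
      using p t W by (subst epowr_le_iff) auto
  qed
qed

subsection \<open>Passage to Borel representatives\<close>

lemma Lp_bound_iff_Lp_norm:
  fixes f :: "real ^ 'n \<Rightarrow> 'b::real_normed_vector"
  assumes "0 < p" "0 \<le> m" "f \<in> borel_measurable borel"
  shows "Lp_bound p f m \<longleftrightarrow> Lp_norm p f \<le> ennreal m"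
  using assms by (simp add: Lp_bound_def Lp_norm_def nn_integral_completion epowr_le_iff)

lemma Lp_norm_cong_AE:
  assumes "AE x in lborel. f x = g x"
  shows "Lp_norm p f = Lp_norm p g"
  unfolding Lp_norm_def nn_integral_completion
  by (intro arg_cong2[where f=epowr] nn_integral_cong_AE refl) (use assms in auto)

lemma AE_lborel_translation:
  fixes P :: "'a::euclidean_space \<Rightarrow> bool"
  assumes "AE x in lborel. P x"
  shows "AE x in lborel. P (x + h)"
proof -
  obtain N where N: "{x \<in> space lborel. \<not> P x} \<subseteq> N" "emeasure lborel N = 0" "N \<in> sets lborel"
    using assms by (rule AE_E)
  then have [measurable]: "N \<in> sets borel" by simp
  have "N \<in> null_sets lborel" using N by auto
  then have "AE x in distr lborel borel ((+) h). x \<notin> N"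
    unfolding lborel_distr_plus by (rule AE_not_in)
  then have "AE x in lborel. h + x \<notin> N"
    by (subst (asm) AE_distr_iff) auto
  then show ?thesis
    using N(1) by (auto simp: add.commute elim!: eventually_mono)
qed

lemma AE_difference_cong:
  fixes f g :: "real ^ 'n \<Rightarrow> 'b::real_normed_vector"
  assumes "AE x in lborel. f x = g x"
  shows "AE x in lborel. (difference h ^^ k) f x = (difference h ^^ k) g x"
proof (induction k)
  case (Suc k)
  from Suc AE_lborel_translation[OF Suc, of h] show ?case
    by eventually_elim (simp add: difference_def)
qed (use assms in simp)

lemma modulus_of_smoothness_cong_AE:
  assumes "AE x in lborel. f x = g x"
  shows "modulus_of_smoothness k p f t = modulus_of_smoothness k p g t"
  unfolding modulus_of_smoothness_def
  by (intro SUP_cong refl Lp_norm_cong_AE AE_difference_cong assms)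

text \<open>Values of \<open>f\<close> enter only through integrals over cubes, hence the two
  maximal functions agree at every point and so do their rearrangements.\<close>

lemma sharp_maximal_cong_AE:
  fixes f g :: "real ^ 'n \<Rightarrow> 'b::{banach, second_countable_topology}"
  assumes [measurable]: "f \<in> borel_measurable lebesgue" "g \<in> borel_measurable lebesgue"
    and eq: "AE x in lborel. f x = g x"
  shows "sharp_maximal f = sharp_maximal g"
proof
  fix x
  have "average Q f = average Q g" if "Q \<in> cubes" for Q
  proof -
    have [measurable]: "Q \<in> sets lebesgue" using that by (auto simp: cubes_def)
    show ?thesis
      unfolding average_def set_lebesgue_integral_def
      by (intro arg_cong2[where f=scaleR] refl integral_cong_AE)
         (use AE_completion[OF eq] in auto)
  qed
  then show "sharp_maximal f x = sharp_maximal g x"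
    unfolding sharp_maximal_def nn_integral_completion using eq
    by (intro SUP_cong refl arg_cong2[where f="(/)"] nn_integral_cong_AE) auto
qed

text \<open>The estimates above are for Borel functions, while \<open>Lp\<close> consists of
  Lebesgue measurable ones. Real and imaginary parts are corrected separately on null sets.\<close>

lemma ex_borel_representative:
  fixes f :: "'a::euclidean_space \<Rightarrow> complex"
  assumes "f \<in> borel_measurable lebesgue"
  obtains g where "g \<in> borel_measurable borel" "AE x in lborel. f x = g x"
proof -
  have "(\<lambda>x. Re (f x)) \<in> borel_measurable (completion lborel)"
    "(\<lambda>x. Im (f x)) \<in> borel_measurable (completion lborel)"
    using assms by measurable
  from this[THEN completion_ex_borel_measurable_real] obtain u v
    where uv: "u \<in> borel_measurable lborel" "AE x in lborel. Re (f x) = u x"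
      "v \<in> borel_measurable lborel" "AE x in lborel. Im (f x) = v x"
    by blast
  have [measurable]: "u \<in> borel_measurable borel" "v \<in> borel_measurable borel"
    using uv by simp_all
  show ?thesis
  proof (rule that[of "\<lambda>x. Complex (u x) (v x)"])
    show "(\<lambda>x. Complex (u x) (v x)) \<in> borel_measurable borel"
      unfolding Complex_eq by measurable
    show "AE x in lborel. f x = Complex (u x) (v x)"
      using uv(2,4) by eventually_elim (simp add: complex_eq_iff)
  qed
qed

subsection \<open>Growth of the modulus of smoothness\<close>

text \<open>
  The sharp constant \<open>2 powr (p - 1)\<close> matters: it yields the factor exactly \<open>2 ^ k\<close> when \<open>h\<close> is
  doubled, which is what the case \<open>k = d / p\<close> requires.
\<close>

lemma powr_add_le_convex:
  fixes a b p :: real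
  assumes "0 \<le> a" "0 \<le> b" "1 < p"
  shows "(a + b) powr p \<le> 2 powr (p - 1) * (a powr p + b powr p)"
proof (cases "a = 0 \<or> b = 0")
  case True
  have "1 \<le> 2 powr (p - 1)" using assms by (simp add: ge_one_powr_ge_zero)
  then have "1 * c \<le> 2 powr (p - 1) * c" if "0 \<le> c" for c
    using that by (rule mult_right_mono)
  from this[of "a powr p"] this[of "b powr p"] show ?thesis using True by auto
next
  case False
  have "((1 - 1 / 2) *\<^sub>R a + (1 / 2) *\<^sub>R b) powr p \<le> (1 - 1 / 2) * a powr p + (1 / 2) * b powr p"
    using assms False powr_convex[of p] by (intro convex_onD) auto
  then have "((a + b) / 2) powr p \<le> (a powr p + b powr p) / 2"
    by (simp add: field_simps)
  then show ?thesis
    using assms by (simp add: powr_divide powr_diff field_simps)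
qed

text \<open>Minkowski's inequality for two equal bounds needs only convexity of the power, because
  \<open>2 powr (p - 1) * (2 * w powr p) = (2 * w) powr p\<close>.\<close>

lemma Lp_bound_add_same:
  fixes f g :: "'a::euclidean_space \<Rightarrow> 'b::{banach, second_countable_topology}"
  assumes p: "1 < p" and f: "Lp_bound p f w" and g: "Lp_bound p g w"
  shows "Lp_bound p (\<lambda>x. f x + g x) (2 * w)"
proof -
  note [measurable] = Lp_boundD(1)[OF f] Lp_boundD(1)[OF g]
  note w = Lp_boundD(2)[OF f]
  have "(\<integral>\<^sup>+x. ennreal (norm (f x + g x) powr p) \<partial>lborel)
    \<le> (\<integral>\<^sup>+x. ennreal (2 powr (p - 1)) * (ennreal (norm (f x) powr p) + ennreal (norm (g x) powr p)) \<partial>lborel)"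
  proof (rule nn_integral_mono)
    fix x
    have "norm (f x + g x) powr p \<le> (norm (f x) + norm (g x)) powr p"
      using p by (intro powr_mono2 norm_triangle_ineq) auto
    also have "\<dots> \<le> 2 powr (p - 1) * (norm (f x) powr p + norm (g x) powr p)"
      using p by (intro powr_add_le_convex) auto
    finally show "ennreal (norm (f x + g x) powr p)
        \<le> ennreal (2 powr (p - 1)) * (ennreal (norm (f x) powr p) + ennreal (norm (g x) powr p))"
      by (simp add: ennreal_mult[symmetric] ennreal_plus[symmetric] ennreal_leI del: ennreal_plus)
  qed
  also have "\<dots> = ennreal (2 powr (p - 1)) * ((\<integral>\<^sup>+x. ennreal (norm (f x) powr p) \<partial>lborel)
      + (\<integral>\<^sup>+x. ennreal (norm (g x) powr p) \<partial>lborel))"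
    by (simp add: nn_integral_cmult nn_integral_add)
  also have "\<dots> \<le> ennreal (2 powr (p - 1)) * (ennreal (w powr p) + ennreal (w powr p))"
    by (intro mult_left_mono add_mono Lp_boundD[OF f] Lp_boundD[OF g]) auto
  also have "\<dots> = ennreal (2 powr (p - 1) * (w powr p + w powr p))"
    by (simp add: ennreal_mult[symmetric] ennreal_plus[symmetric] del: ennreal_plus)
  also have "2 powr (p - 1) * (w powr p + w powr p) = (2 * w) powr p"
    using w by (simp add: powr_mult powr_diff)
  finally show ?thesis using w by (simp add: Lp_bound_def)
qed

lemma difference_commute: "difference h (difference h' f) = difference h' (difference h f)"
  by (rule ext) (simp add: difference_def algebra_simps)

lemma difference_funpow_commute:
  "difference h ((difference h' ^^ k) f) = (difference h' ^^ k) (difference h f)"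
  by (induction k) (simp_all add: difference_commute[of h])

lemma difference_double: "difference (2 *\<^sub>R h) f x = difference h f (x + h) + difference h f x"
  by (simp add: difference_def scaleR_2 add.assoc)

text \<open>Doubling the step factors the difference as \<Delta>_(2h) = (translation by h +
  identity) \<Delta>_h. Each of the \<open>k\<close> factors costs 2, and differences commute, so
  the induction can run over \<open>difference h f\<close> in place of \<open>f\<close>.\<close>

lemma Lp_bound_difference_double:
  fixes f :: "real ^ 'n \<Rightarrow> 'b::{banach, second_countable_topology}"
  assumes "1 < p" "Lp_bound p ((difference h ^^ k) f) w"
  shows "Lp_bound p ((difference (2 *\<^sub>R h) ^^ k) f) (2 ^ k * w)"
  using assms(2)
proof (induction k arbitrary: f)
  case (Suc k)
  let ?G = "(difference (2 *\<^sub>R h) ^^ k) f"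
  have "Lp_bound p ((difference h ^^ k) (difference h f)) w"
    using Suc.prems by (simp add: difference_funpow_commute)
  from Suc.IH[OF this] have *: "Lp_bound p (difference h ?G) (2 ^ k * w)"
    by (simp add: difference_funpow_commute)
  have "(difference (2 *\<^sub>R h) ^^ Suc k) f = (\<lambda>x. difference h ?G (x + h) + difference h ?G x)"
    by (simp add: difference_double[abs_def] fun_eq_iff difference_double)
  with Lp_bound_add_same[OF assms(1) Lp_bound_translation[OF *, of h] *] show ?case
    by (simp add: mult.assoc)
qed simp

lemma Lp_bound_difference_dyadic:
  fixes f :: "real ^ 'n \<Rightarrow> 'b::{banach, second_countable_topology}"
  assumes p: "1 < p" and t: "\<And>h. norm h \<le> t \<Longrightarrow> Lp_bound p ((difference h ^^ k) f) w"
    and h: "norm h \<le> 2 ^ j * t"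
  shows "Lp_bound p ((difference h ^^ k) f) ((2 ^ j) ^ k * w)"
  using h
proof (induction j arbitrary: h)
  case (Suc j)
  have "Lp_bound p ((difference ((1 / 2) *\<^sub>R h) ^^ k) f) ((2 ^ j) ^ k * w)"
    using Suc.prems by (intro Suc.IH) simp
  from Lp_bound_difference_double[OF p this] show ?case
    by (simp add: power_mult_distrib mult.assoc)
qed (use t in simp)

text \<open>For the least \<open>j\<close> with \<open>u \<le> 2 ^ j * t\<close> one has
  \<open>2 ^ j \<le> 2 * (u / t)\<close>, so doubling gives the growth factor
  \<open>(2 * (u / t)) ^ k\<close>. As \<open>u / t > 1\<close>, the exponent may be raised from
  \<open>k\<close> to \<open>e\<close>, which is the form of bound required for
  \<open>W = 2 ^ k * t powr (- e) * w\<close>.\<close>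

lemma Lp_bound_difference_growth:
  fixes f :: "real ^ 'n \<Rightarrow> 'b::{banach, second_countable_topology}"
  assumes p: "1 < p" and t: "0 < t" and \<omega>: "\<And>h. norm h \<le> t \<Longrightarrow> Lp_bound p ((difference h ^^ k) f) w"
    and u: "t < u" and h: "norm h \<le> u" and e: "real k \<le> e"
  shows "Lp_bound p ((difference h ^^ k) f) (u powr e * (2 ^ k * t powr (- e) * w))"
proof -
  have w: "0 \<le> w" using \<omega>[of 0] t by (auto intro: Lp_boundD)
  obtain n where "u / t < 2 ^ n"
    using real_arch_pow[of 2 "u / t"] by auto
  then have ex: "u \<le> 2 ^ n * t" using t by (simp add: field_simps)
  define j where "j = (LEAST n. u \<le> 2 ^ n * t)"
  have j: "u \<le> 2 ^ j * t" unfolding j_def using ex by (rule LeastI)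
  \<comment> \<open>Since \<open>t < u\<close>, the least exponent is positive, and its predecessor
    violates the bound; this gives the upper estimate for \<open>2 ^ j\<close>.\<close>
  have "j \<noteq> 0" using j u by (intro notI) simp
  then obtain i where i: "j = Suc i" using not0_implies_Suc by blast
  have "\<not> u \<le> 2 ^ i * t"
    using not_less_Least[of i "\<lambda>n. u \<le> 2 ^ n * t"] i by (simp add: j_def[symmetric])
  then have "2 ^ j \<le> 2 * (u / t)" using t by (simp add: i field_simps)
  then have "(2 ^ j) ^ k \<le> (2 * (u / t)) ^ k" by (intro power_mono) auto
  also have "\<dots> = 2 ^ k * (u / t) powr k"
    using t u by (simp add: power_mult_distrib powr_realpow del: times_divide_eq_right)
  also have "\<dots> \<le> 2 ^ k * (u / t) powr e"
    using t u e by (intro mult_left_mono powr_mono) auto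
  also have "\<dots> = u powr e * (2 ^ k * t powr (- e))"
    using t u by (simp add: powr_divide powr_minus_divide)
  finally have "(2 ^ j) ^ k * w \<le> u powr e * (2 ^ k * t powr (- e)) * w"
    using w by (rule mult_right_mono)
  then show ?thesis
    using p h j by (intro Lp_bound_mono[OF Lp_bound_difference_dyadic[OF p \<omega>, of t h j]]) (auto simp: mult.assoc)
qed

section \<open>Derivation of the two inequalities\<close>

theorem corollary2p2:
  fixes k :: nat and p :: real
  assumes "1 \<le> k" and "1 < p"
  shows
    "(real k > real CARD('n::finite) / p \<longrightarrow>
        (\<exists>C>0. \<forall>f \<in> (Lp p :: (real ^ 'n \<Rightarrow> complex) set). \<forall>t>0.
          ennreal (t powr (- (real CARD('n) / p))) *
            epowr (\<integral>\<^sup>+ u\<in>{0<..<t ^ CARD('n)}. epowr (rearrangement (sharp_maximal f) u) p \<partial>lborel) (1 / p)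
          \<le> ennreal C *
            (SUP u \<in> {t<..}. ennreal (u powr (- (real CARD('n) / p))) * modulus_of_smoothness k p f u)))
     \<and>
     (real k \<le> real CARD('n) / p \<longrightarrow>
        (\<exists>C>0. \<forall>f \<in> (Lp p :: (real ^ 'n \<Rightarrow> complex) set). \<forall>t>0.
          epowr (\<integral>\<^sup>+ u\<in>{0<..<t ^ CARD('n)}. epowr (rearrangement (sharp_maximal f) u) p \<partial>lborel) (1 / p)
          \<le> ennreal C * modulus_of_smoothness k p f t))"
proof -
  note p = \<open>1 < p\<close>
  define e where "e = real CARD('n) / p"
  let ?lhs = "\<lambda>(f :: real ^ 'n \<Rightarrow> complex) t.
    epowr (\<integral>\<^sup>+ u\<in>{0<..<t ^ CARD('n)}. epowr (rearrangement (sharp_maximal f) u) p \<partial>lborel) (1 / p)"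
  obtain C where C: "0 < C" and main:
    "\<And>(f :: real ^ 'n \<Rightarrow> complex) m t W. Lp_bound p f m \<Longrightarrow> 0 < t \<Longrightarrow> 0 \<le> W \<Longrightarrow>
      (\<And>u h. t < u \<Longrightarrow> norm h \<le> u \<Longrightarrow> Lp_bound p ((difference h ^^ k) f) (u powr e * W)) \<Longrightarrow>
      ?lhs f t \<le> ennreal (C * (t powr e * W))"
    using sharp_maximal_rearrangement_bound[OF p, where 'n='n and 'b=complex and k=k, folded e_def] by blast
  \<comment> \<open>Everything the main estimate asks of \<open>f\<close> is transferred to a Borel
    representative at once. The extended-real modulus enters only through real upper bounds
    \<open>v\<close>.\<close>
  have rep: "\<exists>(g :: real ^ 'n \<Rightarrow> complex) m. Lp_bound p g m \<and> sharp_maximal f = sharp_maximal g \<and>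
      (\<forall>u v h. 0 \<le> v \<longrightarrow> modulus_of_smoothness k p f u \<le> ennreal v \<longrightarrow> norm h \<le> u \<longrightarrow>
        Lp_bound p ((difference h ^^ k) g) v)"
    if f: "f \<in> Lp p" for f :: "real ^ 'n \<Rightarrow> complex"
  proof -
    have fm: "f \<in> borel_measurable lebesgue" and fin: "Lp_norm p f < top"
      using f by (auto simp: Lp_def)
    obtain g where g [measurable]: "g \<in> borel_measurable borel" and eq: "AE x in lborel. f x = g x"
      using fm by (rule ex_borel_representative)
    obtain m where m: "0 \<le> m" "Lp_norm p f = ennreal m"
      using fin by (cases "Lp_norm p f") auto
    have "Lp_bound p g m"
      using p m g by (simp add: Lp_bound_iff_Lp_norm Lp_norm_cong_AE[OF eq, symmetric])
    moreover have "sharp_maximal f = sharp_maximal g"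
      using g by (intro sharp_maximal_cong_AE fm eq measurable_completion) simp
    moreover have "Lp_bound p ((difference h ^^ k) g) v"
      if "0 \<le> v" "modulus_of_smoothness k p f u \<le> ennreal v" "norm h \<le> u" for u v h
    proof -
      have "Lp_norm p ((difference h ^^ k) g) \<le> modulus_of_smoothness k p g u"
        unfolding modulus_of_smoothness_def using that by (intro SUP_upper) simp
      also have "\<dots> \<le> ennreal v"
        using that by (simp add: modulus_of_smoothness_cong_AE[OF eq, symmetric])
      finally show ?thesis
        using p that Lp_boundD(1)[OF Lp_bound_difference[OF p \<open>Lp_bound p g m\<close>]]
        by (subst Lp_bound_iff_Lp_norm) auto
    qed
    ultimately show ?thesis by blast
  qed
  have "ennreal (t powr (- e)) * ?lhs f t
      \<le> ennreal C * (SUP u \<in> {t<..}. ennreal (u powr (- e)) * modulus_of_smoothness k p f u)"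
    if f: "f \<in> Lp p" and t: "0 < t" for f :: "real ^ 'n \<Rightarrow> complex" and t
  proof (cases "SUP u \<in> {t<..}. ennreal (u powr (- e)) * modulus_of_smoothness k p f u")
    case top
    show ?thesis unfolding top using C by (simp add: ennreal_mult_top)
  next
    case (real W)
    obtain g :: "real ^ 'n \<Rightarrow> complex" and m where g: "Lp_bound p g m" "sharp_maximal f = sharp_maximal g"
      and \<omega>: "\<And>u v h. 0 \<le> v \<Longrightarrow> modulus_of_smoothness k p f u \<le> ennreal v \<Longrightarrow> norm h \<le> u \<Longrightarrow>
        Lp_bound p ((difference h ^^ k) g) v"
      using rep[OF f] by blast
    have "?lhs g t \<le> ennreal (C * (t powr e * W))"
    proof (rule main[OF g(1) t real(1)])
      fix u and h :: "real ^ 'n" assume u: "t < u" and h: "norm h \<le> u"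
      have "ennreal (u powr (- e)) * modulus_of_smoothness k p f u \<le> ennreal W"
        unfolding real(2)[symmetric] using u by (intro SUP_upper) simp
      \<comment> \<open>Multiplying by \<open>u powr e\<close> cancels the negative power and leaves
        a bound on the modulus itself.\<close>
      then have "ennreal (u powr e) * (ennreal (u powr (- e)) * modulus_of_smoothness k p f u)
          \<le> ennreal (u powr e) * ennreal W"
        by (rule mult_left_mono) simp
      then have "modulus_of_smoothness k p f u \<le> ennreal (u powr e * W)"
        using t u real(1)
        by (simp add: mult.assoc[symmetric] ennreal_mult[symmetric] powr_add[symmetric])
      then show "Lp_bound p ((difference h ^^ k) g) (u powr e * W)"
        using real(1) h by (intro \<omega>) auto
    qed
    then have "ennreal (t powr (- e)) * ?lhs f t \<le> ennreal (t powr (- e)) * ennreal (C * (t powr e * W))"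
      unfolding g(2) by (rule mult_left_mono) simp
    also have "\<dots> = ennreal (C * (t powr (- e) * t powr e * W))"
      using C real(1) by (simp add: ennreal_mult[symmetric] mult_ac)
    also have "\<dots> = ennreal C * ennreal W"
      using C t real(1) by (simp add: powr_add[symmetric] ennreal_mult)
    finally show ?thesis using real(2) by simp
  qed
  moreover have "?lhs f t \<le> ennreal (C * 2 ^ k) * modulus_of_smoothness k p f t"
    if ke: "real k \<le> e" and f: "f \<in> Lp p" and t: "0 < t" for f :: "real ^ 'n \<Rightarrow> complex" and t
  proof (cases "modulus_of_smoothness k p f t")
    case top
    show ?thesis unfolding top using C by (simp add: ennreal_mult_top)
  next
    case (real w)
    obtain g :: "real ^ 'n \<Rightarrow> complex" and m where g: "Lp_bound p g m" "sharp_maximal f = sharp_maximal g"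
      and \<omega>: "\<And>u v h. 0 \<le> v \<Longrightarrow> modulus_of_smoothness k p f u \<le> ennreal v \<Longrightarrow> norm h \<le> u \<Longrightarrow>
        Lp_bound p ((difference h ^^ k) g) v"
      using rep[OF f] by blast
    \<comment> \<open>The main estimate is used with \<open>W = 2 ^ k * t powr (- e) * w\<close>
      from the growth bound; the powers of \<open>t\<close> then cancel and the constant becomes
      \<open>C * 2 ^ k\<close>.\<close>
    have "?lhs g t \<le> ennreal (C * (t powr e * (2 ^ k * t powr (- e) * w)))"
      using t real ke by (intro main[OF g(1) t] Lp_bound_difference_growth[OF p t] \<omega>[of w t]) auto
    also have "t powr e * (2 ^ k * t powr (- e) * w) = 2 ^ k * (t powr e * t powr (- e)) * w"
      by (simp add: mult_ac)
    also have "\<dots> = 2 ^ k * w" using t by (simp add: powr_add[symmetric])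
    also have "ennreal (C * (2 ^ k * w)) = ennreal (C * 2 ^ k) * ennreal w"
      using C real(1) by (simp add: ennreal_mult[symmetric] mult.assoc)
    finally show ?thesis unfolding g(2) real(2) .
  qed
  ultimately show ?thesis
    using C unfolding e_def by (intro conjI impI exI[of _ C] exI[of _ "C * 2 ^ k"]) auto
qed

end
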